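(* Let $\tilde M$ be either the full mass matrix $M$ or the lumped mass matrix $M_{lump}$ of the linear finite element discretization, and let $A$ be the stiffness matrix. Then the largest eigenvalue of $\tilde M^{-1}A$ is bounded by $$\lambda_{\max}(\tilde M^{-1}A) \le C_* C_{\#} \max_i \sum_{K\in\omega_i}\frac{|K|}{|\omega_i|}\,\bigl\|(F_K')^{-1}\mathbb{D}_K(F_K')^{-T}\bigr\|_2 = C_* C_{\#}\, h_{\mathbb{D}^{-1}}^{-2}\max_i\sum_{K\in\omega_i}\frac{|K|}{|\omega_i|}\,Q_{\mathbb{D}^{-1}}(K),$$ where $C_{\#}=\frac12 C_{\hat\nabla}(d+1)(d+2)$, $C_{\hat\nabla}=\frac{d}{d+1}\left(\frac{\sqrt{d+1}}{d!}\right)^{2/d}$, and $C_*$ is the following constant: for general meshes, $C_*=2(d+1)$ if $\tilde M=M$ and $C_*=d+1$ if $\tilde M=M_{lump}$; for meshes that are nonobtuse with respect to $\mathbb{D}^{-1}$, $C_*=4$ if $\tilde M=M$ and $C_*=2$ if $\tilde M=M_{lump}$.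
   Context: Setting. $d\ge 1$; $\Omega\subset\mathbb{R}^d$ is an interval or a bounded polygonal or polyhedral domain; $\partial\Omega=\Gamma_D\cup\Gamma_N$, where $\Gamma_D$ (Dirichlet part) has positive $(d-1)$-volume (for $d=1$: is nonempty). The diffusion matrix $\mathbb{D}=\mathbb{D}(x)$ is a symmetric and uniformly positive definite $d\times d$ matrix function on $\Omega$. $\mathcal{T}_h$ is an arbitrary (possibly nonuniform and anisotropic) conforming simplicial mesh of $\Omega$ with $N$ elements, with $\Gamma_D$ a union of element faces. $V^h$ is the space of continuous functions that are affine on each element $K\in\mathcal{T}_h$, and $V^h_D=\{v\in V^h: v=0 \text{ on }\Gamma_D\}$. $N_{vi}$ is the number of mesh vertices not lying on $\Gamma_D$, and $\phi_1,\dots,\phi_{N_{vi}}$ are the corresponding nodal (hat) basis functions, which form a basis of $V^h_D$. All indices $i,j$ run from $1$ to $N_{vi}$. Matrices. Mass matrix: $M_{ij}=\int_\Omega \phi_i\phi_j\,dx$. Stiffness matrix: $A_{ij}=\int_\Omega \nabla\phi_i\cdot\mathbb{D}\nabla\phi_j\,dx$. Lumped mass matrix: the diagonal matrix $M_{lump}$ with diagonal entries $M_{ii,lump}=\int_\Omega \phi_i\sum_{j=1}^{N_{vi}}\phi_j\,dx$. $\lambda_{\max}$ denotes the largest eigenvalue and $\|\cdot\|_2$ the spectral norm. Geometry. $|K|$ is the volume of $K$; $\omega_i$ is the patch of the $i$-th vertex (the set of elements having it as a vertex) and $|\omega_i|=\sum_{K\in\omega_i}|K|$. The reference element $\hat K$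 is an equilateral simplex with $|\hat K|=1$; $F_K:\hat K\to K$ is an invertible affine map onto $K$ with (constant) Jacobian matrix $F_K'$, so $|\det F_K'|=|K|$. $\mathbb{D}_K=\frac{1}{|K|}\int_K\mathbb{D}\,dx$. With the metric on $K$ being $\mathbb{D}_K^{-1}$, set $|K|_{\mathbb{D}^{-1}}=|K|\det(\mathbb{D}_K)^{-1/2}$, $|\Omega|_{\mathbb{D}^{-1},h}=\sum_{K\in\mathcal{T}_h}|K|_{\mathbb{D}^{-1}}$, $h_{\mathbb{D}^{-1}}=\left(\frac1N|\Omega|_{\mathbb{D}^{-1},h}\right)^{1/d}$, and the element quality measure $Q_{\mathbb{D}^{-1}}(K)=h_{\mathbb{D}^{-1}}^2\,\|(F_K')^{-1}\mathbb{D}_K(F_K')^{-T}\|_2$. Nonobtuse meshes. The mesh is nonobtuse with respect to $\mathbb{D}^{-1}$ if no element $K$ has an obtuse (dihedral) angle when measured in the metric $\mathbb{D}_K^{-1}$; equivalently, for every $K\in\mathcal{T}_h$ and any two distinct vertices of $K$ with hat functions $\phi,\psi$ (including vertices on $\Gamma_D$), $(\nabla\phi|_K)^T\mathbb{D}_K\nabla\psi|_K\le 0$. *)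

theory Defs
  imports "HOL-Analysis.Analysis"
begin

section \<open>Matrices\<close>

definition spectral_norm :: "real^'n^'n \<Rightarrow> real" where
  "spectral_norm A = onorm (\<lambda>x. A *v x)"

definition eigenvalue :: "real^'n^'n \<Rightarrow> real \<Rightarrow> bool" where
  "eigenvalue A c \<longleftrightarrow> (\<exists>x. x \<noteq> 0 \<and> A *v x = c *\<^sub>R x)"

(* Only applied to products of the inverse of a symmetric positive definite matrix with a
   symmetric matrix, whose complex eigenvalues are all real. *)
definition lambda_max :: "real^'n^'n \<Rightarrow> real" where
  "lambda_max A = Max {c. eigenvalue A c}"


section \<open>Domain, diffusion matrix and mesh\<close>

text \<open>The ambient dimension \<open>d\<close> is \<open>CARD('n)\<close>.\<close>

(* In dimension 1 the pieces of the boundary are single points, so that the domain is a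
   bounded open interval. *)
definition polyhedral_domain :: "(real^'n) set \<Rightarrow> bool" where
  "polyhedral_domain \<Omega> \<longleftrightarrow>
     open \<Omega> \<and> connected \<Omega> \<and> bounded \<Omega> \<and> \<Omega> \<noteq> {} \<and>
     (\<exists>P. finite P \<and> (\<forall>S\<in>P. polytope S \<and> aff_dim S = int CARD('n) - 1) \<and> frontier \<Omega> = \<Union>P)"

(* Integrability is what makes the element averages and the stiffness matrix meaningful;
   it holds in particular for bounded measurable matrix functions. *)
definition diffusion_matrix :: "(real^'n) set \<Rightarrow> (real^'n \<Rightarrow> real^'n^'n) \<Rightarrow> bool" where
  "diffusion_matrix \<Omega> D \<longleftrightarrow>
     D absolutely_integrable_on \<Omega> \<and>
     (\<forall>x\<in>\<Omega>. transpose (D x) = D x) \<and>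
     (\<exists>c>0. \<forall>x\<in>\<Omega>. \<forall>\<xi>. c * (norm \<xi>)\<^sup>2 \<le> \<xi> \<bullet> (D x *v \<xi>))"

(* Conformity (two elements meet in a common, possibly empty, face) is part of triangulation. *)
definition simplicial_mesh :: "(real^'n) set \<Rightarrow> (real^'n) set set \<Rightarrow> bool" where
  "simplicial_mesh \<Omega> T \<longleftrightarrow>
     triangulation T \<and> (\<forall>K\<in>T. int CARD('n) simplex K) \<and> \<Union>T = closure \<Omega>"

(* A union of (d-1)-dimensional element faces has positive (d-1)-volume (for d = 1: is
   nonempty) exactly if at least one face occurs in it. *)
definition dirichlet_part :: "(real^'n) set set \<Rightarrow> (real^'n) set \<Rightarrow> bool" where
  "dirichlet_part T \<Gamma> \<longleftrightarrow>
     (\<exists>\<F>. \<F> \<noteq> {} \<and> (\<forall>f\<in>\<F>. \<exists>K\<in>T. f facet_of K) \<and> \<Gamma> = \<Union>\<F>)"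

definition mesh_vertices :: "(real^'n) set set \<Rightarrow> (real^'n) set" where
  "mesh_vertices T = {v. \<exists>K\<in>T. v extreme_point_of K}"

definition patch :: "(real^'n) set set \<Rightarrow> real^'n \<Rightarrow> (real^'n) set set" where
  "patch T v = {K\<in>T. v extreme_point_of K}"

definition vol :: "(real^'n) set \<Rightarrow> real" where
  "vol K = measure lebesgue K"

definition patch_vol :: "(real^'n) set set \<Rightarrow> real^'n \<Rightarrow> real" where
  "patch_vol T v = (\<Sum>K\<in>patch T v. vol K)"


section \<open>Linear finite elements\<close>

definition fe_space :: "(real^'n) set set \<Rightarrow> (real^'n \<Rightarrow> real) set" where
  "fe_space T = {f. continuous_on (\<Union>T) f \<and> (\<forall>K\<in>T. \<exists>a b. \<forall>x\<in>K. f x = a \<bullet> x + b)}"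

(* The value 0 off the mesh only serves to make the function on the whole space unique. *)
definition hat :: "(real^'n) set set \<Rightarrow> real^'n \<Rightarrow> real^'n \<Rightarrow> real" where
  "hat T v = (THE f. f \<in> fe_space T \<and>
                (\<forall>w\<in>mesh_vertices T. f w = (if w = v then 1 else 0)) \<and>
                (\<forall>x. x \<notin> \<Union>T \<longrightarrow> f x = 0))"

(* Meaningful in the interior of each element, hence almost everywhere, for functions in
   fe_space. *)
definition grad :: "(real^'n \<Rightarrow> real) \<Rightarrow> real^'n \<Rightarrow> real^'n" where
  "grad f x = (THE g. GDERIV f x :> g)"

text \<open>In the following, \<open>\<phi> i\<close> are the basis functions, numbered by a finite type
  \<open>'m\<close>.\<close>

definition mass_matrix :: "(real^'n) set \<Rightarrow> ('m::finite \<Rightarrow> real^'n \<Rightarrow> real) \<Rightarrow> real^'m^'m" where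
  "mass_matrix \<Omega> \<phi> = (\<chi> i j. integral \<Omega> (\<lambda>x. \<phi> i x * \<phi> j x))"

definition lumped_mass_matrix :: "(real^'n) set \<Rightarrow> ('m::finite \<Rightarrow> real^'n \<Rightarrow> real) \<Rightarrow> real^'m^'m" where
  "lumped_mass_matrix \<Omega> \<phi> =
     (\<chi> i j. if i = j then integral \<Omega> (\<lambda>x. \<phi> i x * (\<Sum>k\<in>UNIV. \<phi> k x)) else 0)"

definition stiffness_matrix ::
  "(real^'n) set \<Rightarrow> (real^'n \<Rightarrow> real^'n^'n) \<Rightarrow> ('m::finite \<Rightarrow> real^'n \<Rightarrow> real) \<Rightarrow> real^'m^'m" where
  "stiffness_matrix \<Omega> D \<phi> =
     (\<chi> i j. integral \<Omega> (\<lambda>x. grad (\<phi> i) x \<bullet> (D x *v grad (\<phi> j) x)))"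


section \<open>Mesh geometry with respect to the diffusion matrix\<close>

definition elem_avg :: "(real^'n \<Rightarrow> real^'n^'n) \<Rightarrow> (real^'n) set \<Rightarrow> real^'n^'n" where
  "elem_avg D K = (1 / vol K) *\<^sub>R integral K D"

definition reference_simplex :: "(real^'n) set \<Rightarrow> bool" where
  "reference_simplex S \<longleftrightarrow>
     int CARD('n) simplex S \<and> vol S = 1 \<and>
     (\<exists>l. \<forall>v w. v extreme_point_of S \<and> w extreme_point_of S \<and> v \<noteq> w \<longrightarrow> dist v w = l)"

definition affine_bijection :: "(real^'n \<Rightarrow> real^'n) \<Rightarrow> bool" where
  "affine_bijection F \<longleftrightarrow> bij F \<and> (\<exists>L b. linear L \<and> (\<forall>x. F x = L x + b))"

(* The Jacobian matrix of an affine map is constant; it is evaluated at the origin. *)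
definition jac :: "(real^'n \<Rightarrow> real^'n) \<Rightarrow> real^'n^'n" where
  "jac F = jacobian F (at 0)"

definition metric_norm ::
  "(real^'n \<Rightarrow> real^'n^'n) \<Rightarrow> (real^'n \<Rightarrow> real^'n) \<Rightarrow> (real^'n) set \<Rightarrow> real" where
  "metric_norm D F K =
     spectral_norm (matrix_inv (jac F) ** elem_avg D K ** transpose (matrix_inv (jac F)))"

definition metric_vol :: "(real^'n \<Rightarrow> real^'n^'n) \<Rightarrow> (real^'n) set \<Rightarrow> real" where
  "metric_vol D K = vol K * det (elem_avg D K) powr (- 1 / 2)"

definition metric_h :: "(real^'n) set set \<Rightarrow> (real^'n \<Rightarrow> real^'n^'n) \<Rightarrow> real" where
  "metric_h T D =
     (1 / real (card T) * (\<Sum>K\<in>T. metric_vol D K)) powr (1 / real CARD('n))"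

definition quality ::
  "(real^'n) set set \<Rightarrow> (real^'n \<Rightarrow> real^'n^'n) \<Rightarrow> (real^'n \<Rightarrow> real^'n) \<Rightarrow> (real^'n) set \<Rightarrow> real" where
  "quality T D F K = (metric_h T D)\<^sup>2 * metric_norm D F K"

(* For distinct vertices v, w of K the cosine of the dihedral angle, in the metric given by
   the inverse of elem_avg D K, between the facets opposite to v and w is a negative multiple
   of the product below.  The gradients are constant on the interior of K. *)
definition nonobtuse :: "(real^'n) set set \<Rightarrow> (real^'n \<Rightarrow> real^'n^'n) \<Rightarrow> bool" where
  "nonobtuse T D \<longleftrightarrow>
     (\<forall>K\<in>T. \<forall>v w. v extreme_point_of K \<and> w extreme_point_of K \<and> v \<noteq> w \<longrightarrow>
        (\<forall>x\<in>interior K. grad (hat T v) x \<bullet> (elem_avg D K *v grad (hat T w) x) \<le> 0))"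

definition C_grad :: "nat \<Rightarrow> real" where
  "C_grad d = real d / (real d + 1) * (sqrt (real d + 1) / fact d) powr (2 / real d)"

definition C_sharp :: "nat \<Rightarrow> real" where
  "C_sharp d = 1 / 2 * C_grad d * (real d + 1) * (real d + 2)"

end

theory Submission
  imports Defs
begin


text \<open>
  An eigenvalue \<open>c\<close> of \<open>M\<^sup>-\<^sup>1 A\<close> with eigenvector \<open>x\<close> satisfies \<open>A x = c M x\<close>, hence
  \<open>x \<bullet> A x = c (x \<bullet> M x)\<close>.  As \<open>M\<close> is positive definite, any constant \<open>b\<close> with
  \<open>x \<bullet> A x \<le> b (x \<bullet> M x)\<close> for all \<open>x\<close> bounds all eigenvalues.  Both forms are compared with
  the weighted square sum \<open>W x = (\<Sum>i. x\<^sub>i\<^sup>2 |\<omega>\<^sub>i|)\<close>, in each case element by element.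

  The stiffness form on an element \<open>K\<close> is \<open>|K| (\<nabla>u \<bullet> D\<^sub>K \<nabla>u)\<close> with
  \<open>\<nabla>u = (\<Sum>v. u\<^sub>v \<nabla>\<lambda>\<^sub>v)\<close> the constant gradient in terms of the barycentric coordinates
  \<open>\<lambda>\<^sub>v\<close>.  It is bounded by a multiple \<open>c\<close> of its diagonal part
  \<open>(\<Sum>v. u\<^sub>v\<^sup>2 (\<nabla>\<lambda>\<^sub>v \<bullet> D\<^sub>K \<nabla>\<lambda>\<^sub>v))\<close>: by convexity with \<open>c = d + 1\<close>
  (\<open>quadratic_form_sum_le_card\<close>), and with \<open>c = 2\<close> if the off-diagonal entries are nonpositive,
  since then the zero row sums make the local matrix diagonally dominant
  (\<open>quadratic_form_sum_le_two\<close>).  Pulling \<open>\<nabla>\<lambda>\<^sub>v\<close> back to the reference element shows that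
  each diagonal entry is at most \<open>C_grad d\<close> times the spectral norm in the quality measure,
  because all reference gradients have squared length \<open>C_grad d\<close>
  (\<open>bary_grad_form_le_metric_norm\<close>).  Collecting the contributions of each vertex gives
  \<open>x \<bullet> A x \<le> c C_grad(d) R (W x)\<close>, where \<open>R\<close> is the maximal patch average.

  For the mass forms everything rests on the identity
  \<open>\<integral>\<^sub>K \<lambda>\<^sub>v \<lambda>\<^sub>w = |K| (1 + \<delta>\<^sub>v\<^sub>w) / ((d+1)(d+2))\<close> (\<open>integral_bary_product\<close>).  It makes the
  local mass matrix a multiple of the identity plus the matrix of ones, so that
  \<open>x \<bullet> M x \<ge> k W(x) / ((d+1)(d+2))\<close> with \<open>k = 1\<close> for the full mass matrix; for the lumped one,
  dropping the nonnegative off-diagonal integrals leaves \<open>k = 2\<close>.  The constant \<open>C\<^sub>*\<close> is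
  \<open>2c/k\<close> in all four cases.
\<close>


section \<open>Generalized symmetric eigenvalue problems\<close>

lemma symmetric_inner_commute:
  fixes A :: "real^'m^'m"
  assumes "transpose A = A"
  shows "x \<bullet> (A *v y) = y \<bullet> (A *v x)"
  by (metis assms dot_lmul_matrix inner_commute transpose_matrix_vector)

text \<open>
  A minimiser of a semidefinite form is a critical point: otherwise a small step from \<open>x\<close> in the
  direction \<open>- N x\<close> would make the form negative.
\<close>

lemma semidefinite_null_vector:
  fixes N :: "real^'m^'m"
  assumes sym: "transpose N = N" and psd: "\<And>x. 0 \<le> x \<bullet> (N *v x)" and x: "x \<bullet> (N *v x) = 0"
  shows "N *v x = 0"
proof (rule ccontr)
  let ?y = "N *v x"
  assume "?y \<noteq> 0"
  then have pos: "0 < ?y \<bullet> ?y" by simp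
  let ?q = "?y \<bullet> (N *v ?y)"
  \<comment> \<open>Any smaller positive step would do; the 1 avoids division by 0.\<close>
  define s where "s = (?y \<bullet> ?y) / (?q + 1)"
  have q: "0 \<le> ?q" by (rule psd)
  then have s: "0 < s" using pos by (simp add: s_def)
  have "(x - s *\<^sub>R ?y) \<bullet> (N *v (x - s *\<^sub>R ?y)) = - 2 * s * (?y \<bullet> ?y) + s\<^sup>2 * ?q"
    using x symmetric_inner_commute[OF sym, of x ?y]
    by (simp add: matrix_vector_mult_diff_distrib scaleR_vector_matrix_assoc
        matrix_vector_mult_scaleR inner_diff_left inner_diff_right power2_eq_square algebra_simps)
  then have "2 * s * (?y \<bullet> ?y) \<le> s * (s * ?q)"
    using psd[of "x - s *\<^sub>R ?y"] by (simp add: power2_eq_square)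
  then have "2 * (?y \<bullet> ?y) \<le> s * ?q" using s by simp
  also have "s * ?q \<le> ?y \<bullet> ?y"
    using q pos by (simp add: s_def field_simps)
  finally show False using pos by simp
qed

text \<open>
  The maximal Rayleigh quotient \<open>c\<close> over the sphere is an eigenvalue: \<open>c M - A\<close> is semidefinite
  and its form vanishes at the maximiser.
\<close>

lemma generalized_eigenvalue_exists:
  fixes A M :: "real^'m^'m"
  assumes A: "transpose A = A" and M: "transpose M = M"
    and pd: "\<And>x. x \<noteq> 0 \<Longrightarrow> 0 < x \<bullet> (M *v x)"
  obtains c x where "x \<noteq> 0" "A *v x = c *\<^sub>R (M *v x)"
proof -
  let ?r = "\<lambda>x. (x \<bullet> (A *v x)) / (x \<bullet> (M *v x))"
  have cont: "continuous_on (sphere 0 1) ?r"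
  proof (rule continuous_on_divide)
    have "continuous_on X ((*v) B)" for X :: "(real^'m) set" and B :: "real^'m^'m"
      by (rule linear_continuous_on[OF matrix_vector_mul_bounded_linear])
    then show "continuous_on (sphere 0 1) (\<lambda>x. x \<bullet> (A *v x))"
      "continuous_on (sphere 0 1) (\<lambda>x. x \<bullet> (M *v x))"
      by (auto intro!: continuous_intros)
    show "\<forall>x\<in>sphere 0 1. x \<bullet> (M *v x) \<noteq> 0"
    proof
      fix x :: "real^'m" assume "x \<in> sphere 0 1"
      then have "x \<noteq> 0" by auto
      then show "x \<bullet> (M *v x) \<noteq> 0" using pd[of x] by simp
    qed
  qed
  obtain x0 where x0: "x0 \<in> sphere (0::real^'m) 1" and max: "\<And>x. x \<in> sphere 0 1 \<Longrightarrow> ?r x \<le> ?r x0"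
    using continuous_attains_sup[OF compact_sphere _ cont] by auto
  define c where "c = ?r x0"
  define N where "N = c *\<^sub>R M - A"
  have Nv: "N *v x = c *\<^sub>R (M *v x) - A *v x" for x
    by (simp add: N_def matrix_vector_mult_diff_rdistrib scaleR_matrix_vector_assoc)
  have "x0 \<noteq> 0" using x0 by auto
  have psd: "0 \<le> x \<bullet> (N *v x)" for x
  proof (cases "x = 0")
    case False
    let ?u = "(1 / norm x) *\<^sub>R x"
    have "?u \<in> sphere 0 1" using False by simp
    then have "?r ?u \<le> c" unfolding c_def by (rule max)
    moreover have "?r ?u = ?r x" using False by (simp add: matrix_vector_mult_scaleR)
    ultimately have "?r x \<le> c" by (simp only:)
    then have "x \<bullet> (A *v x) \<le> c * (x \<bullet> (M *v x))" using pd[OF False] by (simp add: pos_divide_le_eq)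
    then show ?thesis by (simp add: Nv inner_diff_right)
  qed simp
  have "transpose N = N" using A M by (simp add: N_def transpose_def vec_eq_iff)
  moreover have "x0 \<bullet> (N *v x0) = 0"
    using pd[OF \<open>x0 \<noteq> 0\<close>] by (simp add: Nv inner_diff_right c_def)
  ultimately have "N *v x0 = 0" using psd semidefinite_null_vector by blast
  then show ?thesis using that[OF \<open>x0 \<noteq> 0\<close>, of c] by (simp add: Nv)
qed

text \<open>
  Eigenvectors for distinct eigenvalues are orthogonal in the inner product given by \<open>M\<close>, hence
  linearly independent.
\<close>

lemma finite_generalized_eigenvalues:
  fixes A M :: "real^'m^'m"
  assumes A: "transpose A = A" and M: "transpose M = M"
    and pd: "\<And>x. x \<noteq> 0 \<Longrightarrow> 0 < x \<bullet> (M *v x)"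
  shows "finite {c. \<exists>x. x \<noteq> 0 \<and> A *v x = c *\<^sub>R (M *v x)}"
proof -
  let ?E = "{c. \<exists>x. x \<noteq> 0 \<and> A *v x = c *\<^sub>R (M *v x)}"
  obtain e where e: "\<And>c. c \<in> ?E \<Longrightarrow> e c \<noteq> 0" "\<And>c. c \<in> ?E \<Longrightarrow> A *v e c = c *\<^sub>R (M *v e c)"
    using bchoice[of ?E "\<lambda>c x. x \<noteq> 0 \<and> A *v x = c *\<^sub>R (M *v x)"] by auto
  have orth: "e c \<bullet> (M *v e c') = 0" if "c \<in> ?E" "c' \<in> ?E" "c \<noteq> c'" for c c'
  proof -
    have "c' * (e c \<bullet> (M *v e c')) = e c \<bullet> (A *v e c')" using e(2)[OF that(2)] by simp
    also have "\<dots> = e c' \<bullet> (A *v e c)" by (rule symmetric_inner_commute[OF A])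
    also have "\<dots> = c * (e c' \<bullet> (M *v e c))" using e(2)[OF that(1)] by simp
    also have "e c' \<bullet> (M *v e c) = e c \<bullet> (M *v e c')" by (rule symmetric_inner_commute[OF M])
    finally show ?thesis using that(3) by simp
  qed
  have inj: "inj_on e ?E"
  proof (rule inj_onI)
    fix c c' assume c: "c \<in> ?E" "c' \<in> ?E" "e c = e c'"
    then have "e c \<bullet> (M *v e c') > 0" using pd[OF e(1)] by simp
    then show "c = c'" using orth[OF c(1,2)] by force
  qed
  have "independent (e ` ?E)"
    unfolding dependent_explicit
  proof clarify
    fix t u v
    assume t: "finite t" "t \<subseteq> e ` ?E" and sum: "(\<Sum>w\<in>t. u w *\<^sub>R w) = 0" and v: "v \<in> t" "u v \<noteq> 0"
    have "0 = (\<Sum>w\<in>t. u w *\<^sub>R w) \<bullet> (M *v v)" using sum by simp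
    also have "\<dots> = (\<Sum>w\<in>t. u w * (w \<bullet> (M *v v)))" by (simp add: inner_sum_left)
    also have "\<dots> = (\<Sum>w\<in>t. if w = v then u v * (v \<bullet> (M *v v)) else 0)"
    proof (rule sum.cong)
      fix w assume "w \<in> t"
      then obtain c c' where "c \<in> ?E" "c' \<in> ?E" "w = e c" "v = e c'" using t v by blast
      then show "u w * (w \<bullet> (M *v v)) = (if w = v then u v * (v \<bullet> (M *v v)) else 0)"
        using orth by auto
    qed simp
    also have "\<dots> = u v * (v \<bullet> (M *v v))" using t v by simp
    finally have "v \<bullet> (M *v v) = 0" using v by simp
    moreover obtain c where "c \<in> ?E" "v = e c" using t v by blast
    ultimately show False using pd[OF e(1)] by force
  qed
  then have "finite (e ` ?E)" by (rule independent_imp_finite)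
  then show ?thesis using inj by (rule finite_imageD)
qed

lemma matrix_inv_inverse:
  fixes M :: "'a::semiring_1^'m^'m"
  assumes "invertible M"
  shows "M ** matrix_inv M = mat 1" "matrix_inv M ** M = mat 1"
  using someI_ex[OF assms[unfolded invertible_def]] unfolding matrix_inv_def by auto

text \<open>
  The maximum in \<^const>\<open>lambda_max\<close> is that of a finite nonempty set, so it is attained by an
  eigenvalue.
\<close>

lemma lambda_max_le:
  fixes A M :: "real^'m^'m"
  assumes A: "transpose A = A" and M: "transpose M = M"
    and pd: "\<And>x. x \<noteq> 0 \<Longrightarrow> 0 < x \<bullet> (M *v x)"
    and le: "\<And>x. x \<bullet> (A *v x) \<le> b * (x \<bullet> (M *v x))"
  shows "lambda_max (matrix_inv M ** A) \<le> b"
proof -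
  have "inj ((*v) M)"
  proof (rule injI)
    fix x y assume "M *v x = M *v y"
    then have "(x - y) \<bullet> (M *v (x - y)) = 0" by (simp add: matrix_vector_mult_diff_distrib)
    then show "x = y" using pd[of "x - y"] by force
  qed
  then have "invertible M" using matrix_left_invertible_injective invertible_left_inverse by blast
  note inv = matrix_inv_inverse[OF this]
  have "matrix_inv M ** A *v x = c *\<^sub>R x \<longleftrightarrow> A *v x = c *\<^sub>R (M *v x)" for c x
  proof
    assume "matrix_inv M ** A *v x = c *\<^sub>R x"
    then have "M *v (matrix_inv M ** A *v x) = M *v (c *\<^sub>R x)" by simp
    then show "A *v x = c *\<^sub>R (M *v x)"
      by (simp add: matrix_vector_mul_assoc matrix_mul_assoc inv matrix_vector_mult_scaleR)
  next
    assume "A *v x = c *\<^sub>R (M *v x)"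
    then have "matrix_inv M *v (A *v x) = matrix_inv M *v (c *\<^sub>R (M *v x))" by simp
    then show "matrix_inv M ** A *v x = c *\<^sub>R x"
      by (simp add: matrix_vector_mul_assoc inv matrix_vector_mult_scaleR)
  qed
  then have E: "{c. eigenvalue (matrix_inv M ** A) c} = {c. \<exists>x. x \<noteq> 0 \<and> A *v x = c *\<^sub>R (M *v x)}"
    by (simp add: eigenvalue_def)
  have "c \<le> b" if "x \<noteq> 0" "A *v x = c *\<^sub>R (M *v x)" for c x
    using le[of x] that pd[OF that(1)] by simp
  moreover obtain c x where "x \<noteq> 0" "A *v x = c *\<^sub>R (M *v x)"
    using generalized_eigenvalue_exists[OF A M pd] .
  ultimately show ?thesis
    unfolding lambda_max_def E using finite_generalized_eigenvalues[OF A M pd]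
    by (subst Max_le_iff) blast+
qed


section \<open>Barycentric coordinates\<close>

definition simplex_vertices :: "(real^'n) set \<Rightarrow> bool" where
  "simplex_vertices S \<longleftrightarrow> \<not> affine_dependent S \<and> card S = CARD('n) + 1"

text \<open>
  The value 0 if \<open>v\<close> is not a vertex, here and for \<open>bary\<close>, is what the hat function of \<open>v\<close>
  and its gradient have on an element without the vertex \<open>v\<close>.
\<close>

definition bary_grad :: "(real^'n) set \<Rightarrow> real^'n \<Rightarrow> real^'n" where
  "bary_grad S v = (if v \<in> S then SOME g. \<forall>w\<in>S - {v}. g \<bullet> (w - v) = -1 else 0)"

definition bary :: "(real^'n) set \<Rightarrow> real^'n \<Rightarrow> real^'n \<Rightarrow> real" where
  "bary S v x = (if v \<in> S then 1 + bary_grad S v \<bullet> (x - v) else 0)"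

lemma simplex_vertices_finite: "simplex_vertices S \<Longrightarrow> finite S"
  unfolding simplex_vertices_def by (auto intro: aff_independent_finite)

lemma simplex_vertices_nonempty: "simplex_vertices S \<Longrightarrow> S \<noteq> {}"
  unfolding simplex_vertices_def by auto

lemma bary_grad_edge:
  fixes S :: "(real^'n) set"
  assumes S: "simplex_vertices S" and "v \<in> S" "w \<in> S" "w \<noteq> v"
  shows "bary_grad S v \<bullet> (w - v) = -1"
proof -
  have "independent ((\<lambda>x. -v + x) ` (S-{v}))"
    using S \<open>v \<in> S\<close> affine_dependent_iff_dependent2 unfolding simplex_vertices_def by blast
  then obtain f :: "real^'n \<Rightarrow> real" where f: "linear f"
    and fv: "\<And>x. x \<in> (\<lambda>x. -v + x) ` (S-{v}) \<Longrightarrow> f x = -1"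
    using linear_independent_extend[of _ "\<lambda>_. -1::real"] by metis
  have "adjoint f 1 \<bullet> (u - v) = -1" if "u \<in> S - {v}" for u
  proof -
    have "adjoint f 1 \<bullet> (u - v) = f (u - v)"
      using adjoint_works[OF f, of "u - v" 1] by (simp add: inner_commute)
    also have "f (u - v) = -1" using fv that by auto
    finally show ?thesis .
  qed
  then have "\<exists>g. \<forall>w\<in>S - {v}. g \<bullet> (w - v) = -1" by blast
  then have "\<forall>w\<in>S - {v}. bary_grad S v \<bullet> (w - v) = -1"
    unfolding bary_grad_def if_P[OF \<open>v \<in> S\<close>] by (rule someI_ex)
  then show ?thesis using assms by blast
qed

lemma bary_vertex:
  assumes "simplex_vertices S" "w \<in> S"
  shows "bary S v w = (if w = v then 1 else 0)"
  using bary_grad_edge[OF assms(1) _ assms(2)] assms by (auto simp: bary_def)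

lemma bary_add: "bary S v (x + y) = bary S v x + bary_grad S v \<bullet> y"
  by (auto simp: bary_def bary_grad_def inner_diff_right inner_add_right)

text \<open>
  Moving along an edge direction transfers weight from one barycentric coordinate to another and
  leaves the remaining ones unchanged.
\<close>

lemma bary_shift:
  assumes "simplex_vertices S" "w \<in> S" "w' \<in> S"
  shows "bary S v (x + c *\<^sub>R (w - w')) = bary S v x + c * ((if w = v then 1 else 0) - (if w' = v then 1 else 0))"
proof -
  have "bary S v w = bary S v w' + bary_grad S v \<bullet> (w - w')"
    using bary_add[of S v w' "w - w'"] by simp
  then have "bary_grad S v \<bullet> (w - w') = (if w = v then 1 else 0) - (if w' = v then 1 else 0)"
    using bary_vertex[OF assms(1)] assms(2,3) by simp
  then show ?thesis by (simp add: bary_add)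
qed

lemma bary_affine_form: "\<exists>b. \<forall>x. bary S v x = bary_grad S v \<bullet> x + b"
proof -
  have "bary S v x = bary_grad S v \<bullet> x + bary S v 0" for x
    using bary_add[of S v 0 x] by simp
  then show ?thesis by blast
qed

lemma affine_combination:
  fixes a :: "real^'n"
  assumes "sum u S = 1"
  shows "a \<bullet> (\<Sum>w\<in>S. u w *\<^sub>R w) + b = (\<Sum>w\<in>S. u w * (a \<bullet> w + b))"
proof -
  have "(\<Sum>w\<in>S. u w * (a \<bullet> w + b)) = (\<Sum>w\<in>S. u w * (a \<bullet> w)) + sum u S * b"
    by (simp add: distrib_left sum.distrib sum_distrib_right)
  then show ?thesis using assms by (simp add: inner_sum_right)
qed

lemma affine_zero_on_vertices:
  fixes a :: "real^'n"
  assumes S: "simplex_vertices S" and z: "\<And>w. w \<in> S \<Longrightarrow> a \<bullet> w + b = 0"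
  shows "a = 0" "b = 0"
proof -
  have "affine hull S = UNIV"
    using S affine_independent_span_gt[of S] by (simp add: simplex_vertices_def)
  then have zero: "a \<bullet> x + b = 0" for x
  proof -
    have "x \<in> affine hull S" using \<open>affine hull S = UNIV\<close> by simp
    then obtain u where u: "sum u S = 1" "(\<Sum>v\<in>S. u v *\<^sub>R v) = x"
      using affine_hull_finite[OF simplex_vertices_finite[OF S]] by auto
    show ?thesis using affine_combination[OF u(1), of a b] u(2) z by simp
  qed
  show "b = 0" using zero[of 0] by simp
  with zero[of a] show "a = 0" by simp
qed

lemma affine_eq_on_vertices:
  fixes a a' :: "real^'n"
  assumes S: "simplex_vertices S" and z: "\<And>w. w \<in> S \<Longrightarrow> a \<bullet> w + b = a' \<bullet> w + b'"
  shows "a = a'" "b = b'"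
proof -
  have "(a - a') \<bullet> w + (b - b') = 0" if "w \<in> S" for w
    using z[OF that] by (simp add: inner_diff_left)
  from affine_zero_on_vertices[OF S this] show "a = a'" "b = b'" by auto
qed

text \<open>
  Barycentric coordinates are recognised by their values at the vertices; all later identifications
  of affine functions (on mesh elements, on the reference element, on an equilateral simplex) go
  through this lemma.
\<close>

lemma bary_unique:
  assumes S: "simplex_vertices S"
    and z: "\<And>w. w \<in> S \<Longrightarrow> a \<bullet> w + b = (if w = v then 1 else 0)"
  shows "a = bary_grad S v" "a \<bullet> x + b = bary S v x"
proof -
  obtain b' where b': "\<And>x. bary S v x = bary_grad S v \<bullet> x + b'" using bary_affine_form by blast
  have "a \<bullet> w + b = bary_grad S v \<bullet> w + b'" if "w \<in> S" for w
    using z[OF that] bary_vertex[OF S that, of v] b' by simp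
  from affine_eq_on_vertices[OF S this] show "a = bary_grad S v" "a \<bullet> x + b = bary S v x"
    using b' by auto
qed

lemma bary_combination:
  assumes S: "simplex_vertices S"
  shows "(\<Sum>v\<in>S. bary S v x *\<^sub>R v) = x" "(\<Sum>v\<in>S. bary S v x) = 1"
proof -
  have fin: "finite S" using S by (rule simplex_vertices_finite)
  have "affine hull S = UNIV"
    using S affine_independent_span_gt[of S] by (simp add: simplex_vertices_def)
  then obtain u where u: "sum u S = 1" "(\<Sum>v\<in>S. u v *\<^sub>R v) = x"
    using affine_hull_finite[OF fin] by blast
  have "bary S v x = u v" if "v \<in> S" for v
  proof -
    obtain b where b: "\<And>x. bary S v x = bary_grad S v \<bullet> x + b" using bary_affine_form by blast
    have "bary S v x = (\<Sum>w\<in>S. u w * bary S v w)"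
      using affine_combination[OF u(1), of "bary_grad S v" b] u(2) b by simp
    also have "\<dots> = (\<Sum>w\<in>S. if w = v then u w else 0)"
      using bary_vertex[OF S] by (intro sum.cong) auto
    finally show ?thesis using that fin by simp
  qed
  then show "(\<Sum>v\<in>S. bary S v x *\<^sub>R v) = x" "(\<Sum>v\<in>S. bary S v x) = 1"
    using u by auto
qed

text \<open>
  The barycentric coordinates sum to 1, so their gradients sum to 0.  These are the zero row sums of
  the local stiffness matrix.
\<close>

lemma sum_bary_grad:
  assumes S: "simplex_vertices S"
  shows "(\<Sum>v\<in>S. bary_grad S v) = 0"
proof -
  let ?g = "\<Sum>v\<in>S. bary_grad S v"
  have "(\<Sum>v\<in>S. bary S v ?g) = (\<Sum>v\<in>S. bary S v 0) + (\<Sum>v\<in>S. bary_grad S v \<bullet> ?g)"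
    using bary_add[of S _ 0 ?g] by (simp add: sum.distrib)
  then have "?g \<bullet> ?g = 0" using bary_combination(2)[OF S] by (simp add: inner_sum_left)
  then show ?thesis by simp
qed

lemma mem_simplex_iff_bary:
  assumes S: "simplex_vertices S"
  shows "x \<in> convex hull S \<longleftrightarrow> (\<forall>v\<in>S. 0 \<le> bary S v x)"
proof
  have fin: "finite S" using S by (rule simplex_vertices_finite)
  assume "x \<in> convex hull S"
  then obtain u where u: "\<forall>v\<in>S. 0 \<le> u v" "sum u S = 1" "(\<Sum>v\<in>S. u v *\<^sub>R v) = x"
    using convex_hull_finite[OF fin] by auto
  show "\<forall>v\<in>S. 0 \<le> bary S v x"
  proof
    fix v assume v: "v \<in> S"
    obtain b where b: "\<And>x. bary S v x = bary_grad S v \<bullet> x + b" using bary_affine_form by blast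
    have "bary S v x = (\<Sum>w\<in>S. u w * bary S v w)"
      using affine_combination[OF u(2), of "bary_grad S v" b] u(3) b by simp
    also have "\<dots> \<ge> 0"
      using u(1) bary_vertex[OF S] by (intro sum_nonneg mult_nonneg_nonneg) auto
    finally show "0 \<le> bary S v x" .
  qed
next
  have fin: "finite S" using S by (rule simplex_vertices_finite)
  assume "\<forall>v\<in>S. 0 \<le> bary S v x"
  then show "x \<in> convex hull S"
    using convex_hull_finite[OF fin] bary_combination[OF S, of x] by auto
qed

lemma bary_nonneg:
  assumes "simplex_vertices S" "x \<in> convex hull S"
  shows "0 \<le> bary S v x"
  using assms mem_simplex_iff_bary[OF assms(1)] by (cases "v \<in> S") (auto simp: bary_def[of S v])

lemma continuous_on_bary [continuous_intros]: "continuous_on X (bary S v)"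
proof -
  obtain b where "\<And>x. bary S v x = bary_grad S v \<bullet> x + b" using bary_affine_form by blast
  then have "bary S v = (\<lambda>x. bary_grad S v \<bullet> x + b)" by auto
  then show ?thesis by (simp add: continuous_intros)
qed

lemma simplex_compact: "simplex_vertices S \<Longrightarrow> compact (convex hull S)"
  by (simp add: finite_imp_compact_convex_hull simplex_vertices_finite)

lemma simplex_not_negligible:
  assumes S: "simplex_vertices S"
  shows "\<not> negligible (convex hull S)"
proof -
  have "interior (convex hull S) = rel_interior (convex hull S)"
    using S by (simp add: affine_independent_span_gt rel_interior_interior simplex_vertices_def)
  moreover have "rel_interior (convex hull S) \<noteq> {}"
    using simplex_vertices_nonempty[OF S] by (simp add: rel_interior_eq_empty)
  ultimately show ?thesis by (simp add: negligible_convex_interior)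
qed

lemma vol_simplex_pos:
  assumes S: "simplex_vertices S"
  shows "0 < vol (convex hull S)"
proof -
  have "convex hull S \<in> lmeasurable" using S by (simp add: lmeasurable_compact simplex_compact)
  then show ?thesis using simplex_not_negligible[OF S]
    by (metis vol_def measure_nonneg less_eq_real_def negligible_iff_measure)
qed


section \<open>Affine changes of variables in arbitrary finite dimension\<close>

text \<open>
  The change-of-variables formula and the volume formula for simplices presuppose ordered
  coordinates.  Every finite index type has a well-ordered copy, an initial segment of the natural
  numbers, and relabelling coordinates preserves Lebesgue measure, so both carry over.
\<close>

typedef (overloaded) ('n::finite) ordered_index = "{..<CARD('n)}"
  by (rule exI[of _ 0]) simp

instantiation ordered_index :: (finite) linorder
begin
definition "i \<le> j \<longleftrightarrow> Rep_ordered_index i \<le> Rep_ordered_index j"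
definition "i < j \<longleftrightarrow> Rep_ordered_index i < Rep_ordered_index j"
instance
  by intro_classes
     (auto simp: less_eq_ordered_index_def less_ordered_index_def Rep_ordered_index_inject)
end

instance ordered_index :: (finite) wellorder
proof
  fix P :: "'a ordered_index \<Rightarrow> bool" and a
  assume step: "\<And>x. (\<And>y. y < x \<Longrightarrow> P y) \<Longrightarrow> P x"
  show "P a"
    by (induction a rule: measure_induct_rule[where f = Rep_ordered_index])
       (use step in \<open>auto simp: less_ordered_index_def\<close>)
qed

lemma bij_betw_Rep_ordered_index:
  "bij_betw (Rep_ordered_index :: 'n ordered_index \<Rightarrow> nat) UNIV {..<CARD('n::finite)}"
  by (rule bij_betwI[where g = Abs_ordered_index])
     (use Rep_ordered_index in \<open>auto simp: Rep_ordered_index_inverse Abs_ordered_index_inverse\<close>)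

instance ordered_index :: (finite) finite
  by intro_classes (use bij_betw_finite[OF bij_betw_Rep_ordered_index] in simp)

lemma card_ordered_index: "CARD('n::finite ordered_index) = CARD('n)"
  using bij_betw_same_card[OF bij_betw_Rep_ordered_index] by simp

definition index_bij :: "'n::finite ordered_index \<Rightarrow> 'n" where
  "index_bij = (SOME f. bij f)"

lemma bij_index_bij: "bij (index_bij :: 'n::finite ordered_index \<Rightarrow> 'n)"
proof -
  have "\<exists>f :: 'n ordered_index \<Rightarrow> 'n. bij f"
    using finite_same_card_bij[of "UNIV :: 'n ordered_index set" "UNIV :: 'n set"]
    by (simp add: card_ordered_index)
  then show ?thesis unfolding index_bij_def by (rule someI_ex)
qed

definition reindex :: "real^'n \<Rightarrow> real^('n ordered_index)" where
  "reindex x = (\<chi> i. x $ index_bij i)"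

definition unreindex :: "real^('n ordered_index) \<Rightarrow> real^'n" where
  "unreindex y = (\<chi> j. y $ inv index_bij j)"

lemma unreindex_reindex [simp]: "unreindex (reindex x) = x"
  by (simp add: reindex_def unreindex_def vec_eq_iff bij_is_surj[OF bij_index_bij] surj_f_inv_f)

lemma reindex_unreindex [simp]: "reindex (unreindex y) = y"
  by (simp add: reindex_def unreindex_def vec_eq_iff bij_is_inj[OF bij_index_bij])

lemma linear_reindex: "linear reindex"
  by (auto intro!: linearI simp: reindex_def vec_eq_iff)

lemma linear_unreindex: "linear unreindex"
  by (auto intro!: linearI simp: unreindex_def vec_eq_iff)

lemma reindex_inner [simp]: "reindex x \<bullet> reindex y = x \<bullet> y"
  unfolding inner_vec_def reindex_def
  using sum.reindex_bij_betw[OF bij_index_bij, of "\<lambda>j. x $ j * y $ j"] by simp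

lemma prod_inner_Basis_cart: "(\<Prod>b\<in>Basis. (x :: real^'k) \<bullet> b) = (\<Prod>i\<in>UNIV. x $ i)"
proof -
  have "inj (\<lambda>i. axis i (1::real) :: real^'k)" by (auto intro!: injI simp: axis_eq_axis)
  moreover have "Basis = range (\<lambda>i. axis i (1::real) :: real^'k)" by (auto simp: Basis_vec_def)
  ultimately show ?thesis
    using prod.reindex[of "\<lambda>i. axis i (1::real) :: real^'k" UNIV "\<lambda>b. x \<bullet> b"]
    by (simp add: inner_axis)
qed

lemma continuous_on_linear_vec:
  fixes f :: "real^'a \<Rightarrow> real^'b"
  shows "linear f \<Longrightarrow> continuous_on A f"
  by (simp add: linear_continuous_on linear_conv_bounded_linear)

text \<open>
  Both measures agree on boxes, whose side lengths are merely permuted.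
\<close>

lemma distr_reindex: "distr lborel borel reindex = (lborel :: (real^('n::finite ordered_index)) measure)"
proof (rule lborel_eqI[symmetric])
  fix l u :: "real^('n ordered_index)"
  assume "\<And>b. b \<in> Basis \<Longrightarrow> l \<bullet> b \<le> u \<bullet> b"
  then have le: "l $ i \<le> u $ i" for i
    using cart_eq_inner_axis[of l i] cart_eq_inner_axis[of u i] axis_in_Basis_iff[of i "1::real"] by simp
  have meas: "reindex \<in> borel_measurable (borel :: (real^'n) measure)"
    by (intro borel_measurable_continuous_onI continuous_on_linear_vec linear_reindex)
  have eq: "reindex -` box l u = (box (unreindex l) (unreindex u) :: (real^'n) set)"
  proof -
    have "(\<forall>i. l $ i < x $ index_bij i \<and> x $ index_bij i < u $ i) \<longleftrightarrow>
        (\<forall>j. l $ inv index_bij j < x $ j \<and> x $ j < u $ inv index_bij j)" for x :: "real^'n"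
      by (metis bij_index_bij bij_inv_eq_iff)
    then show ?thesis by (auto simp: mem_box_cart reindex_def unreindex_def)
  qed
  have "emeasure (distr lborel borel reindex) (box l u) =
      emeasure lborel (box (unreindex l) (unreindex u) :: (real^'n) set)"
    using meas eq by (simp add: emeasure_distr)
  also have "\<dots> = ennreal (\<Prod>j\<in>UNIV. (unreindex u - unreindex l) $ j)"
  proof -
    have "b \<in> Basis \<Longrightarrow> unreindex l \<bullet> b \<le> unreindex u \<bullet> b" for b :: "real^'n"
      using le by (auto simp: Basis_vec_def inner_axis unreindex_def)
    then show ?thesis by (subst emeasure_lborel_box) (simp_all add: prod_inner_Basis_cart)
  qed
  also have "(\<Prod>j\<in>UNIV. (unreindex u - unreindex l :: real^'n) $ j) = (\<Prod>i\<in>UNIV. (u - l) $ i)"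
    unfolding unreindex_def
    using prod.reindex_bij_betw[OF bij_imp_bij_inv[OF bij_index_bij], of "\<lambda>i. u $ i - l $ i"] by simp
  finally show "emeasure (distr lborel borel reindex) (box l u) = ennreal (\<Prod>b\<in>Basis. (u - l) \<bullet> b)"
    by (simp add: prod_inner_Basis_cart)
qed simp

lemma integral_compact_lborel:
  fixes f :: "'a::euclidean_space \<Rightarrow> real"
  assumes "compact S" "continuous_on S f"
  shows "integral S f = (\<integral>x. indicator S x * f x \<partial>lborel)"
  using set_borel_integral_eq_integral(2)[of S f] borel_integrable_compact[OF assms]
  by (simp add: set_integrable_def set_lebesgue_integral_def)

lemma integral_reindex:
  fixes f :: "real^'n \<Rightarrow> real"
  assumes S: "compact S" and f: "continuous_on S f"
  shows "integral (reindex ` S) (\<lambda>y. f (unreindex y)) = integral S f"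
proof -
  have cr: "continuous_on A reindex" for A :: "(real^'n) set"
    by (rule continuous_on_linear_vec[OF linear_reindex])
  have cu: "continuous_on A unreindex" for A :: "(real^('n ordered_index)) set"
    by (rule continuous_on_linear_vec[OF linear_unreindex])
  have S': "compact (reindex ` S)" using S cr by (rule compact_continuous_image[rotated])
  have f': "continuous_on (reindex ` S) (\<lambda>y. f (unreindex y))"
    by (rule continuous_on_compose2[OF f cu]) auto
  have m: "(\<lambda>y. indicator (reindex ` S) y * f (unreindex y)) \<in> borel_measurable borel"
    using borel_integrable_compact[OF S' f'] by (auto dest: borel_measurable_integrable)
  have mr: "reindex \<in> lborel \<rightarrow>\<^sub>M (borel :: (real^('n ordered_index)) measure)"
    using cr[of UNIV] by (simp add: borel_measurable_continuous_onI)
  have ind: "indicator (reindex ` S) (reindex x) = (indicator S x :: real)" for x :: "real^'n"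
    by (auto simp: indicator_def image_iff) (metis unreindex_reindex)
  have "integral (reindex ` S) (\<lambda>y. f (unreindex y)) =
      (\<integral>y. indicator (reindex ` S) y * f (unreindex y) \<partial>distr lborel borel reindex)"
    by (simp add: integral_compact_lborel[OF S' f'] distr_reindex)
  also have "\<dots> = (\<integral>x. indicator S x * f x \<partial>lborel)"
    using integral_distr[OF mr m] by (simp add: ind)
  finally show ?thesis by (simp add: integral_compact_lborel[OF S f])
qed

lemma absolutely_integrable_continuous_on_compact:
  fixes f :: "'a::euclidean_space \<Rightarrow> 'b::euclidean_space"
  assumes "compact S" "continuous_on S f"
  shows "f absolutely_integrable_on S"
proof -
  have int: "h integrable_on S" if "continuous_on S h" for h :: "'a \<Rightarrow> 'c::euclidean_space"
    using set_borel_integral_eq_integral(1)[of S h] borel_integrable_compact[OF assms(1) that]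
    by (simp add: set_integrable_def)
  have "f integrable_on S" by (rule int[OF assms(2)])
  moreover have "(\<lambda>x. norm (f x)) integrable_on S"
    by (rule int) (intro continuous_intros assms)
  ultimately show ?thesis by (rule absolutely_integrable_onI)
qed

lemma integral_affine_image_wellorder:
  fixes L :: "real^'k::{finite,wellorder} \<Rightarrow> real^'k::_" and f :: "real^'k::_ \<Rightarrow> real"
  assumes L: "linear L" "inj L" and S: "compact S"
    and f: "continuous_on ((\<lambda>x. L x + b) ` S) f"
  shows "integral ((\<lambda>x. L x + b) ` S) f = \<bar>det (matrix L)\<bar> * integral S (\<lambda>x. f (L x + b))"
proof -
  let ?g = "\<lambda>x. L x + b" and ?f = "\<lambda>x. vec (f x) :: real^1"
  have cont: "continuous_on S ?g"
    by (intro continuous_intros continuous_on_linear_vec L)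
  have der: "(?g has_derivative L) (at x within S)" for x
    using bounded_linear_imp_has_derivative L(1) has_derivative_add_const
    by (metis linear_conv_bounded_linear)
  have inj: "inj_on ?g S" using L(2) by (auto simp: inj_on_def)
  have comp: "compact (?g ` S)" using cont S by (rule compact_continuous_image)
  have "continuous_on (?g ` S) ?f"
    unfolding vec_def using f by (intro continuous_on_vec_lambda)
  then have int: "?f absolutely_integrable_on (?g ` S)"
    using comp by (intro absolutely_integrable_continuous_on_compact)
  then have "integral (?g ` S) ?f = integral S (\<lambda>x. \<bar>det (matrix L)\<bar> *\<^sub>R ?f (?g x))"
    using S der inj by (intro integral_change_of_variables) (auto simp: compact_imp_closed)
  then show ?thesis by (simp add: integral_on_1_eq vec_eq_iff)
qed

text \<open>
  Transported along \<^const>\<open>reindex\<close> from ordered coordinates.  The constant (the modulus of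
  the determinant) is left unspecified: being the same for all \<open>b\<close>, \<open>S\<close> and \<open>f\<close>, it can
  be recovered by comparing volumes.
\<close>

lemma integral_affine_image:
  fixes L :: "real^'n \<Rightarrow> real^'n"
  assumes L: "linear L" "inj L"
  shows "\<exists>c. \<forall>b S. \<forall>f :: real^'n \<Rightarrow> real. compact S \<longrightarrow> continuous_on ((\<lambda>x. L x + b) ` S) f \<longrightarrow>
           integral ((\<lambda>x. L x + b) ` S) f = c * integral S (\<lambda>x. f (L x + b))"
proof (intro exI allI impI)
  fix b :: "real^'n" and S and f :: "real^'n \<Rightarrow> real"
  define L' where "L' = reindex \<circ> L \<circ> unreindex"
  define g where "g x = L x + b" for x
  define g' where "g' y = L' y + reindex b" for y
  assume S: "compact S" and f: "continuous_on ((\<lambda>x. L x + b) ` S) f"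
  have L': "linear L'" "inj L'"
    unfolding L'_def using L linear_reindex linear_unreindex
    by (auto intro!: linear_compose inj_compose intro: inj_on_inverseI[of _ unreindex]
        inj_on_inverseI[of _ reindex])
  have g': "g' y = reindex (g (unreindex y))" for y
    by (simp add: g'_def g_def L'_def linear_add[OF linear_reindex])
  have cont: "continuous_on A g" "continuous_on B unreindex" "continuous_on A reindex" for A B
    unfolding g_def by (intro continuous_intros continuous_on_linear_vec L linear_unreindex linear_reindex)+
  have fg: "continuous_on (g ` S) f" using f by (simp add: g_def[abs_def])
  have im: "reindex ` g ` S = g' ` reindex ` S" by (simp add: g' image_image)
  have "integral (g ` S) f = integral (reindex ` g ` S) (\<lambda>y. f (unreindex y))"
    using compact_continuous_image[OF cont(1) S] fg by (simp add: integral_reindex)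
  also have "\<dots> = integral ((\<lambda>y. L' y + reindex b) ` reindex ` S) (\<lambda>y. f (unreindex y))"
    by (simp add: im g'_def[abs_def])
  also have "\<dots> = \<bar>det (matrix L')\<bar> * integral (reindex ` S) (\<lambda>y. f (unreindex (L' y + reindex b)))"
  proof (rule integral_affine_image_wellorder[OF L'])
    show "compact (reindex ` S)" using cont(3) S by (rule compact_continuous_image)
    have "continuous_on (reindex ` g ` S) (\<lambda>y. f (unreindex y))"
      by (rule continuous_on_compose2[OF fg cont(2)]) auto
    then show "continuous_on ((\<lambda>y. L' y + reindex b) ` reindex ` S) (\<lambda>y. f (unreindex y))"
      by (simp add: im g'_def[abs_def])
  qed
  also have "(\<lambda>y. f (unreindex (L' y + reindex b))) = (\<lambda>y. f (g (unreindex y)))"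
    using g' by (simp add: g'_def)
  also have "integral (reindex ` S) \<dots> = integral S (\<lambda>x. f (g x))"
    by (rule integral_reindex[OF S]) (rule continuous_on_compose2[OF fg cont(1)], auto)
  finally show "integral ((\<lambda>x. L x + b) ` S) f =
      \<bar>det (matrix (reindex \<circ> L \<circ> unreindex))\<bar> * integral S (\<lambda>x. f (L x + b))"
    by (simp add: g_def[abs_def] L'_def o_def)
qed


section \<open>Integrals of products of barycentric coordinates\<close>

text \<open>
  Both the halving map and the exchange of two vertices below have this shape.
\<close>

lemma integral_shear_image:
  fixes a q :: "real^'n"
  assumes inj: "inj (\<lambda>x. x + (a \<bullet> x + \<beta>) *\<^sub>R q)"
  obtains c where "\<And>S (f :: real^'n \<Rightarrow> real). compact S \<Longrightarrow> continuous_on UNIV f \<Longrightarrow>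
    integral ((\<lambda>x. x + (a \<bullet> x + \<beta>) *\<^sub>R q) ` S) f = c * integral S (\<lambda>x. f (x + (a \<bullet> x + \<beta>) *\<^sub>R q))"
proof -
  let ?L = "\<lambda>x. x + (a \<bullet> x) *\<^sub>R q"
  have lin: "linear ?L"
    by (auto intro!: linearI simp: algebra_simps inner_add_right scaleR_add_left)
  have eq: "x + (a \<bullet> x + \<beta>) *\<^sub>R q = ?L x + \<beta> *\<^sub>R q" for x
    by (simp add: scaleR_add_left)
  have "inj ?L"
  proof (rule injI)
    fix x y assume "?L x = ?L y"
    then have "x + (a \<bullet> x + \<beta>) *\<^sub>R q = y + (a \<bullet> y + \<beta>) *\<^sub>R q" by (simp only: eq)
    then show "x = y" by (rule injD[OF inj])
  qed
  from integral_affine_image[OF lin this] obtain c where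
    c: "\<forall>b S. \<forall>f :: real^'n \<Rightarrow> real. compact S \<longrightarrow> continuous_on ((\<lambda>x. ?L x + b) ` S) f \<longrightarrow>
      integral ((\<lambda>x. ?L x + b) ` S) f = c * integral S (\<lambda>x. f (?L x + b))" ..
  show ?thesis
  proof (rule that[of c])
    fix S :: "(real^'n) set" and f :: "real^'n \<Rightarrow> real"
    assume "compact S" "continuous_on UNIV f"
    then show "integral ((\<lambda>x. x + (a \<bullet> x + \<beta>) *\<^sub>R q) ` S) f =
        c * integral S (\<lambda>x. f (x + (a \<bullet> x + \<beta>) *\<^sub>R q))"
      using c continuous_on_subset[of UNIV f] by (simp only: eq) simp
  qed
qed

lemma continuous_integrable_simplex:
  fixes f :: "real^'n \<Rightarrow> real"
  assumes "simplex_vertices S" "continuous_on UNIV f"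
  shows "f integrable_on convex hull S"
  using absolutely_integrable_continuous_on_compact[OF simplex_compact[OF assms(1)], of f]
    continuous_on_subset[OF assms(2)] set_lebesgue_integral_eq_integral(1) by blast

lemma integral_one_simplex:
  fixes S :: "(real^'n) set"
  assumes "simplex_vertices S"
  shows "integral (convex hull S) (\<lambda>_. 1) = vol (convex hull S)"
  using lmeasure_integral[of "convex hull S"] lmeasurable_compact[OF simplex_compact[OF assms]]
  by (simp add: vol_def)

text \<open>
  The affine map that fixes all vertices except \<open>w\<close>, which goes to the midpoint of \<open>v\<close> and \<open>w\<close>.
\<close>

definition halving :: "(real^'n) set \<Rightarrow> real^'n \<Rightarrow> real^'n \<Rightarrow> real^'n \<Rightarrow> real^'n" where
  "halving S v w x = x + (bary S w x / 2) *\<^sub>R (v - w)"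

text \<open>
  The affine map that exchanges \<open>v\<close> and \<open>w\<close> and fixes the other vertices.
\<close>

definition vertex_swap :: "(real^'n) set \<Rightarrow> real^'n \<Rightarrow> real^'n \<Rightarrow> real^'n \<Rightarrow> real^'n" where
  "vertex_swap S v w x = x + (bary S w x - bary S v x) *\<^sub>R (v - w)"

context
  fixes S :: "(real^'n) set" and v w :: "real^'n"
  assumes S: "simplex_vertices S" and vw: "v \<in> S" "w \<in> S" "v \<noteq> w"
begin

lemma bary_halving:
  "bary S u (halving S v w x) =
     bary S u x + bary S w x / 2 * ((if v = u then 1 else 0) - (if w = u then 1 else 0))"
  unfolding halving_def by (rule bary_shift[OF S vw(1,2)])

lemma bary_vertex_swap:
  "bary S u (vertex_swap S v w x) =
     bary S u x + (bary S w x - bary S v x) * ((if v = u then 1 else 0) - (if w = u then 1 else 0))"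
  unfolding vertex_swap_def by (rule bary_shift[OF S vw(1,2)])

lemma vertex_swap_involution: "vertex_swap S v w (vertex_swap S v w x) = x"
  using vw(3) unfolding vertex_swap_def[of S v w "vertex_swap S v w x"] bary_vertex_swap
  by (simp add: vertex_swap_def algebra_simps)

lemma inj_halving: "inj (halving S v w)"
proof (rule injI)
  fix x y assume eq: "halving S v w x = halving S v w y"
  then have "bary S w (halving S v w x) = bary S w (halving S v w y)" by simp
  then have "bary S w x = bary S w y" using vw(3) by (simp add: bary_halving)
  with eq show "x = y" by (simp add: halving_def)
qed

lemma inj_vertex_swap: "inj (vertex_swap S v w)"
  by (metis vertex_swap_involution injI)

lemma vertex_swap_image_simplex: "vertex_swap S v w ` (convex hull S) = convex hull S"
proof -
  have "vertex_swap S v w x \<in> convex hull S" if "x \<in> convex hull S" for x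
    using that vw unfolding mem_simplex_iff_bary[OF S] bary_vertex_swap by auto
  then show ?thesis using vertex_swap_involution by (auto simp: image_iff) metis
qed

text \<open>
  The hyperplane on which the coordinates of \<open>v\<close> and \<open>w\<close> agree cuts the simplex into two halves;
  one of them is the image of the whole simplex under the halving map.  The preimage of \<open>y\<close> is
  found by doubling its \<open>w\<close>-coordinate at the expense of its \<open>v\<close>-coordinate.
\<close>

lemma halving_image_simplex:
  "halving S v w ` (convex hull S) = {x \<in> convex hull S. bary S w x \<le> bary S v x}"
proof (intro equalityI subsetI)
  fix y assume "y \<in> halving S v w ` (convex hull S)"
  then obtain x where x: "x \<in> convex hull S" "y = halving S v w x" by blast
  have nn: "0 \<le> bary S u x" for u using bary_nonneg[OF S x(1)] .
  have "y \<in> convex hull S"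
    unfolding mem_simplex_iff_bary[OF S] x(2) bary_halving
  proof
    fix u show "0 \<le> bary S u x + bary S w x / 2 * ((if v = u then 1 else 0) - (if w = u then 1 else 0))"
      using nn[of u] nn[of w] vw(3) by (cases "w = u"; cases "v = u") auto
  qed
  then show "y \<in> {x \<in> convex hull S. bary S w x \<le> bary S v x}"
    using vw nn[of v] nn[of w] by (auto simp: x(2) bary_halving)
next
  fix y assume y: "y \<in> {x \<in> convex hull S. bary S w x \<le> bary S v x}"
  \<comment> \<open>Inverse of the halving map: undo the transfer of half the weight of \<open>w\<close>.\<close>
  define x where "x = y + bary S w y *\<^sub>R (w - v)"
  have b: "bary S u x = bary S u y + bary S w y * ((if w = u then 1 else 0) - (if v = u then 1 else 0))" for u
    unfolding x_def by (rule bary_shift[OF S vw(2,1)])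
  have nn: "0 \<le> bary S u y" for u using bary_nonneg[OF S] y by blast
  have "x \<in> convex hull S"
    unfolding mem_simplex_iff_bary[OF S] b
  proof
    fix u show "0 \<le> bary S u y + bary S w y * ((if w = u then 1 else 0) - (if v = u then 1 else 0))"
      using nn[of u] nn[of w] vw(3) y by (cases "w = u"; cases "v = u") auto
  qed
  moreover have "halving S v w x = y"
    using vw(3) unfolding halving_def b by (simp add: x_def algebra_simps)
  ultimately show "y \<in> halving S v w ` (convex hull S)" by blast
qed

lemma vertex_swap_image_half:
  "vertex_swap S v w ` {x \<in> convex hull S. bary S w x \<le> bary S v x} =
     {x \<in> convex hull S. bary S v x \<le> bary S w x}" (is "_ ` ?H = ?H'")
proof -
  have in_hull: "vertex_swap S v w x \<in> convex hull S" if "x \<in> convex hull S" for x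
    using that vertex_swap_image_simplex by blast
  have "vertex_swap S v w ` ?H \<subseteq> ?H'" "vertex_swap S v w ` ?H' \<subseteq> ?H"
    using vw(3) in_hull by (auto simp: bary_vertex_swap)
  moreover from this(2) have "vertex_swap S v w ` vertex_swap S v w ` ?H' \<subseteq> vertex_swap S v w ` ?H" by (rule image_mono)
  then have "?H' \<subseteq> vertex_swap S v w ` ?H" by (simp add: image_image vertex_swap_involution)
  ultimately show ?thesis by (intro equalityI)
qed

text \<open>
  Both halves of the simplex are affine images of the whole, with scaling constants that are forced
  by the volumes: the exchange of the vertices is volume preserving, as it maps the simplex onto
  itself, and therefore each half has half the volume.
\<close>

lemma integral_simplex_halving:
  fixes f :: "real^'n \<Rightarrow> real"
  assumes f: "continuous_on UNIV f"
  shows "integral (convex hull S) f =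
    1 / 2 * (integral (convex hull S) (\<lambda>x. f (halving S v w x)) +
             integral (convex hull S) (\<lambda>x. f (vertex_swap S v w (halving S v w x))))"
proof -
  let ?K = "convex hull S"
  let ?H = "{x \<in> ?K. bary S w x \<le> bary S v x}" and ?H' = "{x \<in> ?K. bary S v x \<le> bary S w x}"
  obtain \<beta>v \<beta>w where \<beta>: "\<And>x. bary S v x = bary_grad S v \<bullet> x + \<beta>v" "\<And>x. bary S w x = bary_grad S w \<bullet> x + \<beta>w"
    using bary_affine_form by metis
  have hform: "halving S v w = (\<lambda>x. x + (bary_grad S w \<bullet> x + \<beta>w) *\<^sub>R ((1/2) *\<^sub>R (v - w)))"
    by (rule ext) (simp add: halving_def \<beta>)
  have sform: "vertex_swap S v w = (\<lambda>x. x + ((bary_grad S w - bary_grad S v) \<bullet> x + (\<beta>w - \<beta>v)) *\<^sub>R (v - w))"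
    by (rule ext) (simp add: vertex_swap_def \<beta> inner_diff_left algebra_simps)
  obtain c where c: "\<And>X (f :: real^'n \<Rightarrow> real). compact X \<Longrightarrow> continuous_on UNIV f \<Longrightarrow>
      integral (halving S v w ` X) f = c * integral X (\<lambda>x. f (halving S v w x))"
    using integral_shear_image[OF inj_halving[unfolded hform]] unfolding hform by blast
  obtain c' where c': "\<And>X (f :: real^'n \<Rightarrow> real). compact X \<Longrightarrow> continuous_on UNIV f \<Longrightarrow>
      integral (vertex_swap S v w ` X) f = c' * integral X (\<lambda>x. f (vertex_swap S v w x))"
    using integral_shear_image[OF inj_vertex_swap[unfolded sform]] unfolding sform by blast
  have K: "compact ?K" using S by (rule simplex_compact)
  have cs: "continuous_on UNIV (vertex_swap S v w)" and ch: "continuous_on UNIV (halving S v w)"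
    unfolding vertex_swap_def[abs_def] halving_def[abs_def] by (auto intro!: continuous_intros)
  have vol: "0 < integral ?K (\<lambda>_. 1::real)" using vol_simplex_pos[OF S] integral_one_simplex[OF S] by simp
  have "c' = 1" using c'[OF K, of "\<lambda>_. 1::real"] vol by (simp add: vertex_swap_image_simplex continuous_on_const)
  have clH: "compact ?H" "compact ?H'"
  proof -
    have "closed {x. bary S w x \<le> bary S v x}" "closed {x. bary S v x \<le> bary S w x}"
      by (intro closed_Collect_le continuous_on_bary)+
    then show "compact ?H" "compact ?H'"
      using compact_Int_closed[OF K] by (simp_all add: Collect_conj_eq)
  qed
  have split: "integral ?K g = c * (integral ?K (\<lambda>x. g (halving S v w x)) +
      integral ?K (\<lambda>x. g (vertex_swap S v w (halving S v w x))))" if g: "continuous_on UNIV g" for g :: "real^'n \<Rightarrow> real"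
  proof -
    have gs: "continuous_on UNIV (\<lambda>x. g (vertex_swap S v w x))"
      by (rule continuous_on_compose2[OF g cs]) auto
    have "negligible (?H \<inter> ?H')"
    proof (rule negligible_subset)
      have "(bary_grad S w - bary_grad S v) \<bullet> (w - v) = 2"
        using bary_grad_edge[OF S vw(1,2)] bary_grad_edge[OF S vw(2,1)] vw(3)
        by (simp add: inner_diff_left inner_diff_right)
      then have "bary_grad S w - bary_grad S v \<noteq> 0" by auto
      then show "negligible {x. (bary_grad S w - bary_grad S v) \<bullet> x = \<beta>v - \<beta>w}"
        by (intro negligible_hyperplane) simp
      show "?H \<inter> ?H' \<subseteq> {x. (bary_grad S w - bary_grad S v) \<bullet> x = \<beta>v - \<beta>w}"
        by (auto simp: \<beta> inner_diff_left)
    qed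
    moreover have "g integrable_on ?H" "g integrable_on ?H'"
      using absolutely_integrable_continuous_on_compact[OF clH(1), of g]
        absolutely_integrable_continuous_on_compact[OF clH(2), of g]
        continuous_on_subset[OF g] set_lebesgue_integral_eq_integral(1) by blast+
    moreover have "?K = ?H \<union> ?H'" by auto
    ultimately have "integral ?K g = integral ?H g + integral ?H' g"
      using integral_Un[of g ?H ?H'] by simp
    also have "integral ?H' g = integral ?H (\<lambda>x. g (vertex_swap S v w x))"
      using c'[OF clH(1) g] \<open>c' = 1\<close> by (simp add: vertex_swap_image_half)
    also have "integral ?H g = c * integral ?K (\<lambda>x. g (halving S v w x))"
      using c[OF K g] by (simp add: halving_image_simplex)
    also have "integral ?H (\<lambda>x. g (vertex_swap S v w x)) = c * integral ?K (\<lambda>x. g (vertex_swap S v w (halving S v w x)))"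
      using c[OF K gs] by (simp add: halving_image_simplex)
    finally show ?thesis by (simp add: algebra_simps)
  qed
  have "c = 1 / 2" using split[of "\<lambda>_. 1::real"] vol by (simp add: continuous_on_const)
  then show ?thesis using split[OF f] by simp
qed

text \<open>
  On the first half \<open>\<lambda>\<^sub>w\<close> becomes \<open>\<lambda>\<^sub>w / 2\<close>, on the second one it becomes
  \<open>\<lambda>\<^sub>v + \<lambda>\<^sub>w / 2\<close>.  This linear relation between the second moments replaces an explicit
  iterated integration.
\<close>

lemma integral_bary_square_halving:
  "integral (convex hull S) (\<lambda>x. (bary S w x)\<^sup>2) =
     1/4 * integral (convex hull S) (\<lambda>x. (bary S w x)\<^sup>2) +
     1/2 * (integral (convex hull S) (\<lambda>x. (bary S v x)\<^sup>2) +
            integral (convex hull S) (\<lambda>x. bary S v x * bary S w x))"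
proof -
  let ?K = "convex hull S"
  have int: "(\<lambda>x. (bary S w x)\<^sup>2) integrable_on ?K" "(\<lambda>x. (bary S v x)\<^sup>2) integrable_on ?K"
    "(\<lambda>x. bary S v x * bary S w x) integrable_on ?K"
    by (intro continuous_integrable_simplex[OF S] continuous_intros)+
  have "integral ?K (\<lambda>x. (bary S w (halving S v w x))\<^sup>2) = integral ?K (\<lambda>x. 1/4 * (bary S w x)\<^sup>2)"
    using vw(3) by (simp add: bary_halving power2_eq_square)
  also have "\<dots> = 1/4 * integral ?K (\<lambda>x. (bary S w x)\<^sup>2)"
    by (rule integral_mult_right)
  finally have half1: "integral ?K (\<lambda>x. (bary S w (halving S v w x))\<^sup>2) = \<dots>" .
  have "integral ?K (\<lambda>x. (bary S w (vertex_swap S v w (halving S v w x)))\<^sup>2) =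
      integral ?K (\<lambda>x. (bary S v x)\<^sup>2 + (bary S v x * bary S w x + 1/4 * (bary S w x)\<^sup>2))"
    using vw(3) by (simp add: bary_halving bary_vertex_swap power2_eq_square algebra_simps)
  also have "\<dots> = integral ?K (\<lambda>x. (bary S v x)\<^sup>2) + (integral ?K (\<lambda>x. bary S v x * bary S w x)
      + 1/4 * integral ?K (\<lambda>x. (bary S w x)\<^sup>2))"
    using int by (simp add: integral_add integrable_add)
  finally have half2: "integral ?K (\<lambda>x. (bary S w (vertex_swap S v w (halving S v w x)))\<^sup>2) = \<dots>" .
  have "continuous_on UNIV (\<lambda>x. (bary S w x)\<^sup>2)" by (intro continuous_intros)
  from integral_simplex_halving[OF this, unfolded half1 half2] show ?thesis by (simp add: field_simps)
qed

end

text \<open>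
  The halving relation for \<open>(v, w)\<close> and \<open>(w, v)\<close> forces all squares to have the same integral
  \<open>a\<close> and all mixed products to have the integral \<open>a / 2\<close>.  The value of \<open>a\<close> follows because
  the coordinates sum to 1, so that all products together integrate to the volume.
\<close>

lemma integral_bary_product:
  fixes S :: "(real^'n) set"
  assumes S: "simplex_vertices S" and vw: "v \<in> S" "w \<in> S"
  shows "integral (convex hull S) (\<lambda>x. bary S v x * bary S w x) =
    (if v = w then 2 else 1) * vol (convex hull S) / ((real CARD('n) + 1) * (real CARD('n) + 2))"
proof -
  let ?K = "convex hull S" and ?d = "real CARD('n)"
  define J where "J u u' = integral ?K (\<lambda>x. bary S u x * bary S u' x)" for u u'
  have fin: "finite S" using S by (rule simplex_vertices_finite)
  have card: "real (card S) = ?d + 1" using S by (simp add: simplex_vertices_def)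
  have off: "J u u' = J u u / 2 \<and> J u u = J u' u'" if "u \<in> S" "u' \<in> S" "u \<noteq> u'" for u u'
  proof -
    have "J u' u' = 1/4 * J u' u' + 1/2 * (J u u + J u u')"
      using integral_bary_square_halving[OF S that] by (simp add: J_def power2_eq_square)
    moreover have "J u u = 1/4 * J u u + 1/2 * (J u' u' + J u' u)"
      using integral_bary_square_halving[OF S that(2,1)] that(3) by (simp add: J_def power2_eq_square)
    moreover have "J u' u = J u u'" by (simp add: J_def mult.commute)
    ultimately show ?thesis by argo
  qed
  define a where "a = J v v"
  have J: "J u u' = (if u = u' then a else a / 2)" if "u \<in> S" "u' \<in> S" for u u'
  proof -
    have "J u u = a" using off[OF that(1) vw(1)] unfolding a_def by (cases "u = v") auto
    then show ?thesis using off[OF that] by (cases "u = u'") auto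
  qed
  have "vol ?K = integral ?K (\<lambda>x. (\<Sum>u\<in>S. \<Sum>u'\<in>S. bary S u x * bary S u' x))"
    using bary_combination(2)[OF S] integral_one_simplex[OF S]
    by (simp add: sum_product[symmetric])
  also have "\<dots> = (\<Sum>u\<in>S. \<Sum>u'\<in>S. J u u')"
    unfolding J_def using fin
    by (subst integral_sum; (intro integrable_sum continuous_integrable_simplex[OF S] continuous_intros)?)
       (auto intro!: sum.cong integral_sum continuous_integrable_simplex[OF S] continuous_intros)
  also have "\<dots> = (\<Sum>u\<in>S. \<Sum>u'\<in>S. a / 2 + (if u = u' then a / 2 else 0))"
    using J by (intro sum.cong) auto
  also have "\<dots> = (?d + 1) * ((?d + 1) * a / 2 + a / 2)"
    using fin by (simp add: sum.distrib card)
  finally have "vol ?K = a * ((?d + 1) * (?d + 2)) / 2" by (simp add: field_simps)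
  moreover have "(?d + 1) * (?d + 2) > 0" by simp
  ultimately have "a = 2 * vol ?K / ((?d + 1) * (?d + 2))" by (simp add: field_simps)
  then show ?thesis using J[OF vw] unfolding J_def by simp
qed

text \<open>
  The local mass form equals the left-hand side plus a nonnegative multiple of the square of the sum of the
  nodal values.
\<close>

lemma integral_square_lower_bound:
  fixes S :: "(real^'n) set" and u :: "real^'n \<Rightarrow> real"
  assumes S: "simplex_vertices S"
  shows "vol (convex hull S) / ((real CARD('n) + 1) * (real CARD('n) + 2)) * (\<Sum>v\<in>S. (u v)\<^sup>2)
    \<le> integral (convex hull S) (\<lambda>x. (\<Sum>v\<in>S. u v * bary S v x)\<^sup>2)"
proof -
  let ?K = "convex hull S"
  define c where "c = vol ?K / ((real CARD('n) + 1) * (real CARD('n) + 2))"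
  have prod: "integral ?K (\<lambda>x. bary S v x * bary S w x) = c + (if v = w then c else 0)"
    if "v \<in> S" "w \<in> S" for v w
    using integral_bary_product[OF S that] by (simp add: c_def)
  have "c \<ge> 0" by (simp add: c_def vol_def)
  have fin: "finite S" using S by (rule simplex_vertices_finite)
  have "integral ?K (\<lambda>x. (\<Sum>v\<in>S. u v * bary S v x)\<^sup>2) =
      integral ?K (\<lambda>x. \<Sum>v\<in>S. \<Sum>w\<in>S. u v * u w * (bary S v x * bary S w x))"
    by (simp add: power2_eq_square sum_product mult_ac)
  also have "\<dots> = (\<Sum>v\<in>S. \<Sum>w\<in>S. u v * u w * integral ?K (\<lambda>x. bary S v x * bary S w x))"
    using fin
    by (subst integral_sum; (intro integrable_sum continuous_integrable_simplex[OF S] continuous_intros)?)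
       (auto intro!: sum.cong integral_sum[THEN trans] continuous_integrable_simplex[OF S] continuous_intros)
  also have "\<dots> = (\<Sum>v\<in>S. \<Sum>w\<in>S. c * (u v * u w) + (if v = w then c * (u v * u w) else 0))"
    by (intro sum.cong) (auto simp: prod)
  also have "\<dots> = c * (\<Sum>v\<in>S. \<Sum>w\<in>S. u v * u w) + c * (\<Sum>v\<in>S. (u v)\<^sup>2)"
    using fin by (simp add: sum.distrib sum_distrib_left power2_eq_square)
  also have "(\<Sum>v\<in>S. \<Sum>w\<in>S. u v * u w) = (sum u S)\<^sup>2"
    by (simp add: sum_product power2_eq_square)
  finally have "integral ?K (\<lambda>x. (\<Sum>v\<in>S. u v * bary S v x)\<^sup>2) =
      c * (sum u S)\<^sup>2 + c * (\<Sum>v\<in>S. (u v)\<^sup>2)" .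
  moreover have "0 \<le> c * (sum u S)\<^sup>2" using \<open>c \<ge> 0\<close> by simp
  ultimately show ?thesis unfolding c_def by linarith
qed


section \<open>Gradients on an equilateral simplex of unit volume\<close>

text \<open>
  The matrix \<open>G\<close> is the identity plus a product of two vectors of ones.  Conjugation with \<open>P\<close>,
  the identity with one column replaced by ones, turns it into the identity with a single row
  changed, whose determinant is given by Cramer's rule.
\<close>

lemma det_identity_plus_ones:
  "det (\<chi> i j. if i = j then 2 else 1 :: real^'k^'k) = real CARD('k) + 1"
proof -
  obtain k :: 'k where True by simp
  let ?d = "real CARD('k)"
  let ?G = "(\<chi> i j. if i = j then 2 else 1) :: real^'k^'k"
  define P where "P = ((\<chi> i j. if j = k then 1 else if i = j then 1 else 0) :: real^'k^'k)"
  define Q where "Q = ((\<chi> i j. if i = k then (if j = k then ?d + 1 else 1) else if i = j then 1 else 0) :: real^'k^'k)"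
  have "P = (\<chi> i j. if j = k then (mat 1 *v (1 :: real^'k)) $ i else (mat 1 :: real^'k^'k) $ i $ j)"
    by (simp add: P_def vec_eq_iff) (simp add: mat_def)
  then have "det P = 1"
    using cramer_lemma[of k "mat 1 :: real^'k^'k" 1] by simp
  let ?x = "(\<chi> j. if j = k then ?d + 1 else 1) :: real^'k"
  have "(\<Sum>i\<in>UNIV. ?x $ i *s row i (mat 1 :: real^'k^'k)) = ?x"
    by (simp add: vec_eq_iff row_def mat_def if_distrib[of "\<lambda>y. _ * y"] cong: if_cong)
  then have "Q = (\<chi> i. if i = k then (\<Sum>i\<in>UNIV. ?x $ i *s row i (mat 1 :: real^'k^'k)) else row i (mat 1))"
    by (simp add: Q_def vec_eq_iff row_def mat_def)
  then have "det Q = ?d + 1"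
    using cramer_lemma_transpose[where x = ?x and k = k and A = "mat 1 :: real^'k^'k"] by simp
  have "?G ** P = P ** Q"
  proof -
    have "(?G ** P) $ i $ j = (P ** Q) $ i $ j" for i j
    proof -
      have "(P ** Q) $ i $ j = (\<Sum>m\<in>UNIV. P $ i $ m * Q $ m $ j)"
        by (simp add: matrix_matrix_mult_def)
      also have "\<dots> = (\<Sum>m\<in>UNIV. (if m = k then (if j = k then ?d + 1 else 1) else 0) +
          (if m = i then (if i \<noteq> k \<and> i = j then 1 else 0) else 0))"
        by (rule sum.cong) (auto simp: P_def Q_def)
      also have "\<dots> = (if j = k then ?d + 1 else 1) + (if i \<noteq> k \<and> i = j then 1 else 0)"
        by (simp add: sum.distrib)
      finally have PQ: "(P ** Q) $ i $ j = \<dots>" .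
      show ?thesis
      proof (cases "j = k")
        case True
        have "(?G ** P) $ i $ j = (\<Sum>m\<in>UNIV. 1 + (if m = i then 1 else 0))"
          unfolding matrix_matrix_mult_def P_def using True by (auto intro!: sum.cong)
        then show ?thesis using PQ True by (simp add: sum.distrib)
      next
        case False
        have "(?G ** P) $ i $ j = (\<Sum>m\<in>UNIV. ?G $ i $ m * P $ m $ j)"
          by (simp add: matrix_matrix_mult_def)
        also have "\<dots> = (\<Sum>m\<in>UNIV. if m = j then (if i = j then 2 else 1) else 0)"
          using False by (intro sum.cong) (auto simp: P_def)
        finally have "(?G ** P) $ i $ j = \<dots>" .
        then show ?thesis using PQ False by simp
      qed
    qed
    then show ?thesis by (simp add: vec_eq_iff)
  qed
  then have "det ?G * det P = det P * det Q" by (simp flip: det_mul)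
  then show ?thesis using \<open>det P = 1\<close> \<open>det Q = ?d + 1\<close> by simp
qed

lemma det_scaleR_matrix: "det (c *\<^sub>R (A :: real^'k^'k)) = c ^ CARD('k) * det A"
proof -
  have "c *\<^sub>R A = (\<chi> i. c *s A $ i)" by (simp add: vec_eq_iff)
  then show ?thesis using det_rows_mul[of "\<lambda>_. c" "\<lambda>i. A $ i"] by simp
qed

lemma inner_equal_edges:
  fixes x v w :: "'a::real_inner"
  assumes "dist v x = l" "dist w x = l" "dist v w = l'"
  shows "(v - x) \<bullet> (w - x) = l\<^sup>2 - l'\<^sup>2 / 2"
proof -
  have "v - w = (v - x) - (w - x)" by simp
  then have "(norm (v - w))\<^sup>2 = (norm (v - x))\<^sup>2 + (norm (w - x))\<^sup>2 - 2 * ((v - x) \<bullet> (w - x))"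
    unfolding power2_norm_eq_inner by (simp add: inner_diff_left inner_diff_right inner_commute)
  then have "(v - x) \<bullet> (w - x) = ((norm (v - x))\<^sup>2 + (norm (w - x))\<^sup>2 - (norm (v - w))\<^sup>2) / 2"
    by simp
  also have "\<dots> = (l\<^sup>2 + l\<^sup>2 - l'\<^sup>2) / 2" using assms by (simp add: dist_norm)
  finally show ?thesis by (simp add: diff_divide_distrib)
qed

text \<open>
  The edge vectors from one vertex have the Gram matrix \<open>l\<^sup>2/2\<close> times the identity plus the matrix
  of ones, and its determinant is the square of the determinant in the volume formula.
\<close>

lemma content_equilateral_simplex:
  fixes X :: "(real^'k::{finite,wellorder}) set"
  assumes X: "finite X" "card X = Suc CARD('k)"
    and l: "\<And>v w. v \<in> X \<Longrightarrow> w \<in> X \<Longrightarrow> v \<noteq> w \<Longrightarrow> dist v w = l"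
  shows "(measure lborel (convex hull X) * fact CARD('k))\<^sup>2 = (l\<^sup>2 / 2) ^ CARD('k) * (real CARD('k) + 1)"
proof -
  obtain x0 where x0: "x0 \<in> X" using X by fastforce
  have "card (X - {x0}) = CARD('k)" using X x0 by simp
  then obtain f :: "'k \<Rightarrow> (real, 'k) vec" where f: "bij_betw f UNIV (X - {x0})"
    using X(1) finite_same_card_bij[of "UNIV :: 'k set" "X - {x0}"] by auto
  define M where "M = (\<chi> i. \<chi> j. f j $ i - x0 $ i)"
  have vol: "measure lborel (convex hull X) = \<bar>det M\<bar> / fact CARD('k)"
    unfolding M_def by (rule content_simplex[OF X x0 f])
  have fX: "f i \<in> X" "f i \<noteq> x0" for i using f by (auto simp: bij_betw_def)
  have finj: "f i = f j \<longleftrightarrow> i = j" for i j using f by (auto simp: bij_betw_def inj_eq)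
  have "transpose M ** M = (l\<^sup>2 / 2) *\<^sub>R (\<chi> i j. if i = j then 2 else 1)"
  proof -
    have "(transpose M ** M) $ i $ j = (f i - x0) \<bullet> (f j - x0)" for i j
      by (simp add: M_def matrix_matrix_mult_def transpose_def inner_vec_def)
    moreover have "(f i - x0) \<bullet> (f j - x0) = (if i = j then l\<^sup>2 else l\<^sup>2 / 2)" for i j
      using inner_equal_edges[of "f i" x0 l "f j" "if i = j then 0 else l"] l[OF fX(1) fX(1)]
        l[OF fX(1) x0 fX(2)] finj by auto
    ultimately show ?thesis by (simp add: vec_eq_iff)
  qed
  then have "det (transpose M ** M) = det ((l\<^sup>2 / 2) *\<^sub>R (\<chi> i j. if i = j then 2 else 1 :: real^'k::_^'k::_))"
    by (rule arg_cong)
  then have "(det M)\<^sup>2 = (l\<^sup>2 / 2) ^ CARD('k) * (real CARD('k) + 1)"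
    by (simp add: det_mul det_transpose power2_eq_square det_scaleR_matrix det_identity_plus_ones)
  then show ?thesis by (simp add: vol)
qed

lemma vol_equilateral_simplex:
  fixes S :: "(real^'n) set"
  assumes S: "simplex_vertices S"
    and l: "\<And>v w. v \<in> S \<Longrightarrow> w \<in> S \<Longrightarrow> v \<noteq> w \<Longrightarrow> dist v w = l"
  shows "(vol (convex hull S) * fact CARD('n))\<^sup>2 = (l\<^sup>2 / 2) ^ CARD('n) * (real CARD('n) + 1)"
proof -
  have inj: "inj (reindex :: real^'n \<Rightarrow> _)" by (rule inj_on_inverseI[of _ unreindex]) simp
  have iso: "dist (reindex x) (reindex y) = dist x y" for x y :: "real^'n"
    using reindex_inner[of "x - y" "x - y"]
    by (simp add: dist_norm norm_eq_sqrt_inner linear_diff[OF linear_reindex])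
  have hull: "convex hull (reindex ` S) = reindex ` (convex hull S)"
    by (rule convex_hull_linear_image[OF linear_reindex, symmetric])
  have fin: "finite S" using S by (rule simplex_vertices_finite)
  then have comp: "compact (convex hull (reindex ` S))" by (simp add: finite_imp_compact_convex_hull)
  have "vol (convex hull S) = integral (convex hull S) (\<lambda>_. 1)"
    by (rule integral_one_simplex[OF S, symmetric])
  also have "\<dots> = integral (convex hull (reindex ` S)) (\<lambda>_. 1)"
    unfolding hull by (rule integral_reindex[symmetric]) (auto simp: simplex_compact S)
  also have "\<dots> = measure lborel (convex hull (reindex ` S))"
    using lmeasure_integral[OF lmeasurable_compact[OF comp]] comp
    by (simp add: measure_completion compact_imp_closed)
  finally have "vol (convex hull S) = \<dots>" .
  moreover have "card (reindex ` S) = Suc CARD('n ordered_index)"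
    using S inj by (simp add: card_image inj_on_subset card_ordered_index simplex_vertices_def)
  moreover have "dist v w = l" if "v \<in> reindex ` S" "w \<in> reindex ` S" "v \<noteq> w" for v w
  proof -
    from that(1,2) obtain x y where xy: "x \<in> S" "y \<in> S" "v = reindex x" "w = reindex y" by blast
    with that(3) have "x \<noteq> y" by auto
    then show ?thesis using xy l iso by simp
  qed
  ultimately show ?thesis
    using content_equilateral_simplex[of "reindex ` S" l] fin by (simp add: card_ordered_index)
qed

text \<open>
  By symmetry the gradient at \<open>v\<close> is a negative multiple of the sum \<open>e\<close> of the edge vectors
  leaving \<open>v\<close>; the multiple is determined by the slope \<open>-1\<close> along each edge.
\<close>

lemma norm_bary_grad_equilateral:
  fixes S :: "(real^'n) set"
  assumes S: "simplex_vertices S" and v: "v \<in> S"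
    and l: "\<And>v w. v \<in> S \<Longrightarrow> w \<in> S \<Longrightarrow> v \<noteq> w \<Longrightarrow> dist v w = l"
  shows "(norm (bary_grad S v))\<^sup>2 = 2 * real CARD('n) / ((real CARD('n) + 1) * l\<^sup>2)" "l \<noteq> 0"
proof -
  let ?d = "real CARD('n)"
  have fin: "finite S" using S by (rule simplex_vertices_finite)
  have card: "card (S - {v}) = CARD('n)" using S v fin by (simp add: simplex_vertices_def)
  then have "S - {v} \<noteq> {}" by (metis card.empty zero_less_card_finite less_irrefl)
  then obtain w where "w \<in> S" "w \<noteq> v" by blast
  with l v show "l \<noteq> 0" by force
  define e where "e = (\<Sum>w\<in>S - {v}. w - v)"
  have e: "e \<bullet> (w - v) = (?d + 1) * l\<^sup>2 / 2" if w: "w \<in> S - {v}" for w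
  proof -
    have "e \<bullet> (w - v) = (\<Sum>u\<in>S - {v}. l\<^sup>2 / 2 + (if u = w then l\<^sup>2 / 2 else 0))"
      unfolding e_def inner_sum_left
    proof (rule sum.cong)
      fix u assume u: "u \<in> S - {v}"
      show "(u - v) \<bullet> (w - v) = l\<^sup>2 / 2 + (if u = w then l\<^sup>2 / 2 else 0)"
        using inner_equal_edges[of u v l w "if u = w then 0 else l"] u w v l by auto
    qed simp
    also have "\<dots> = (?d + 1) * l\<^sup>2 / 2"
      using fin w card unfolding sum.distrib by (simp add: field_simps)
    finally show ?thesis .
  qed
  define g where "g = (- 2 / ((?d + 1) * l\<^sup>2)) *\<^sub>R e"
  have gw: "g \<bullet> (w - v) = -1" if "w \<in> S - {v}" for w
  proof -
    have "(?d + 1) * l\<^sup>2 \<noteq> 0" using \<open>l \<noteq> 0\<close> by (simp add: add_nonneg_eq_0_iff)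
    then show ?thesis by (simp only: g_def inner_scaleR_left e[OF that]) simp
  qed
  have "g \<bullet> w + (1 - g \<bullet> v) = (if w = v then 1 else 0)" if "w \<in> S" for w
    using gw[of w] that by (auto simp: inner_diff_right)
  then have g: "g = bary_grad S v" by (rule bary_unique(1)[OF S])
  have "g \<bullet> e = - ?d"
    unfolding e_def inner_sum_right using gw card by simp
  then have "g \<bullet> g = 2 * ?d / ((?d + 1) * l\<^sup>2)"
    unfolding g_def by (simp add: g_def[symmetric])
  then show "(norm (bary_grad S v))\<^sup>2 = 2 * ?d / ((?d + 1) * l\<^sup>2)"
    by (simp add: g power2_norm_eq_inner)
qed

text \<open>
  The unit volume determines the edge length, so the gradient length becomes a function of the
  dimension alone.  This is the origin of the constant \<^const>\<open>C_grad\<close>.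
\<close>

lemma norm_bary_grad_reference:
  fixes S :: "(real^'n) set"
  assumes S: "simplex_vertices S" and v: "v \<in> S" and vol: "vol (convex hull S) = 1"
    and l: "\<And>v w. v \<in> S \<Longrightarrow> w \<in> S \<Longrightarrow> v \<noteq> w \<Longrightarrow> dist v w = l"
  shows "(norm (bary_grad S v))\<^sup>2 = C_grad CARD('n)"
proof -
  let ?d = "CARD('n)" and ?y = "sqrt (real CARD('n) + 1) / fact CARD('n)" and ?z = "2 / l\<^sup>2"
  have l0: "l \<noteq> 0" by (rule norm_bary_grad_equilateral(2)[OF S v l])
  have y: "0 < ?y" and z: "0 < ?z" using l0 by (auto simp: add_pos_nonneg)
  have "(fact ?d)\<^sup>2 = (l\<^sup>2 / 2) ^ ?d * (real ?d + 1)"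
    using vol_equilateral_simplex[OF S l] vol by simp
  then have "?y\<^sup>2 = ?z ^ ?d"
    using l0 by (simp add: power_divide field_simps)
  then have "(?y powr 2) powr (1 / ?d) = (?z powr ?d) powr (1 / ?d)"
    using y z by (simp add: powr_realpow)
  then have "?y powr (2 / ?d) = ?z"
    using z y by (simp only: powr_powr) simp
  then show ?thesis
    using norm_bary_grad_equilateral(1)[OF S v l] by (simp add: C_grad_def field_simps)
qed


section \<open>Hat functions on a simplicial mesh\<close>

definition verts :: "(real^'n) set \<Rightarrow> (real^'n) set" where
  "verts K = {v. v extreme_point_of K}"

lemma simplex_verts:
  fixes K :: "(real^'n) set"
  assumes "int CARD('n) simplex K"
  shows "simplex_vertices (verts K)" "convex hull verts K = K"
proof -
  obtain C where C: "\<not> affine_dependent C" "int (card C) = int CARD('n) + 1" "K = convex hull C"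
    using assms unfolding simplex_def by blast
  then have "verts K = C"
    by (simp add: verts_def extreme_point_of_convex_hull_affine_independent)
  with C show "simplex_vertices (verts K)" "convex hull verts K = K"
    by (auto simp: simplex_vertices_def)
qed

text \<open>
  This makes integrals over the domain and over its closure, the union of the elements, agree.
\<close>

lemma negligible_frontier_polyhedral:
  fixes \<Omega> :: "(real^'n) set"
  assumes "polyhedral_domain \<Omega>"
  shows "negligible (frontier \<Omega>)"
proof -
  obtain P where P: "finite P" "\<forall>S\<in>P. polytope S \<and> aff_dim S = int CARD('n) - 1" "frontier \<Omega> = \<Union>P"
    using assms unfolding polyhedral_domain_def by blast
  have "negligible S" if "S \<in> P" for S
  proof -
    have "interior S = {}" using P(2) that by (intro low_dim_interior) auto
    then show ?thesis using P(2) that by (simp add: negligible_convex_interior polytope_imp_convex)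
  qed
  then show ?thesis using P by (simp add: negligible_Union)
qed

context
  fixes \<Omega> :: "(real^'n) set" and T
  assumes mesh: "simplicial_mesh \<Omega> T"
begin

lemma mesh_finite: "finite T"
  using mesh by (simp add: simplicial_mesh_def triangulation_def)

lemma mesh_Union: "\<Union>T = closure \<Omega>"
  using mesh by (simp add: simplicial_mesh_def)

lemma elem_simplex: "K \<in> T \<Longrightarrow> int CARD('n) simplex K"
  using mesh by (simp add: simplicial_mesh_def)

lemma elem_verts: "K \<in> T \<Longrightarrow> simplex_vertices (verts K)"
  by (rule simplex_verts(1)[OF elem_simplex])

lemma elem_hull: "K \<in> T \<Longrightarrow> convex hull verts K = K"
  by (rule simplex_verts(2)[OF elem_simplex])

lemma elem_compact: "K \<in> T \<Longrightarrow> compact K"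
  using simplex_compact[OF elem_verts] elem_hull by fastforce

lemma elem_convex: "K \<in> T \<Longrightarrow> convex K"
  using elem_simplex convex_simplex by blast

lemma elem_vol_pos: "K \<in> T \<Longrightarrow> 0 < vol K"
  using vol_simplex_pos[OF elem_verts] elem_hull by fastforce

lemma verts_subset: "K \<in> T \<Longrightarrow> verts K \<subseteq> K"
  by (auto simp: verts_def extreme_point_of_def)

text \<open>
  Two elements meet in a common face, and on it a point is a convex combination of the common
  vertices only; the coefficients do not depend on the element.  This makes the hat functions well
  defined and continuous.
\<close>

lemma bary_consistent:
  assumes K: "K \<in> T" and K': "K' \<in> T" and x: "x \<in> K" "x \<in> K'"
  shows "bary (verts K) v x = bary (verts K') v x"
proof -
  let ?E = "{w. w extreme_point_of (K \<inter> K')}"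
  have "(K \<inter> K') face_of K" "(K' \<inter> K) face_of K'"
    using mesh K K' by (auto simp: simplicial_mesh_def triangulation_def)
  then have E: "?E \<subseteq> verts K" "?E \<subseteq> verts K'"
    using extreme_point_of_face by (auto simp: verts_def Int_commute)
  have fin: "finite ?E"
    using finite_subset[OF E(1)] simplex_vertices_finite[OF elem_verts[OF K]] by blast
  have "K \<inter> K' = convex hull ?E"
    using elem_compact elem_convex K K'
    by (intro Krein_Milman_Minkowski) (auto simp: compact_Int convex_Int)
  then have "x \<in> convex hull ?E" using x by blast
  then obtain u where u: "sum u ?E = 1" "(\<Sum>w\<in>?E. u w *\<^sub>R w) = x"
    unfolding convex_hull_finite[OF fin] by blast
  have "bary S v x = (\<Sum>w\<in>?E. u w * (if w = v then 1 else 0))"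
    if S: "simplex_vertices S" and "?E \<subseteq> S" for S
  proof -
    obtain b where b: "\<And>x. bary S v x = bary_grad S v \<bullet> x + b" using bary_affine_form by blast
    have "bary S v x = (\<Sum>w\<in>?E. u w * bary S v w)"
      using affine_combination[OF u(1), of "bary_grad S v" b] u(2) b by simp
    also have "\<dots> = (\<Sum>w\<in>?E. u w * (if w = v then 1 else 0))"
      using bary_vertex[OF S] \<open>?E \<subseteq> S\<close> by (intro sum.cong) (auto simp: subset_iff)
    finally show ?thesis .
  qed
  from this[OF elem_verts[OF K] E(1)] this[OF elem_verts[OF K'] E(2)] show ?thesis by simp
qed

text \<open>
  Gluing the barycentric coordinates of the elements gives a function with the defining properties
  of the hat function, and affine functions on an element are determined at its vertices, so there
  is no other.  This includes the elements of which \<open>v\<close> is not a vertex, where both sides vanish.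
\<close>

lemma hat_eq_bary:
  assumes K: "K \<in> T" and x: "x \<in> K"
  shows "hat T v x = bary (verts K) v x"
proof -
  let ?P = "\<lambda>f. f \<in> fe_space T \<and> (\<forall>w\<in>mesh_vertices T. f w = (if w = v then 1 else 0)) \<and>
    (\<forall>x. x \<notin> \<Union>T \<longrightarrow> f x = 0)"
  define f where "f x = (if x \<in> \<Union>T then bary (verts (SOME K. K \<in> T \<and> x \<in> K)) v x else 0)" for x
  have f: "f x = bary (verts K) v x" if "K \<in> T" "x \<in> K" for K x
  proof -
    let ?K = "SOME K. K \<in> T \<and> x \<in> K"
    have "?K \<in> T \<and> x \<in> ?K"
      by (rule someI[of "\<lambda>K. K \<in> T \<and> x \<in> K" K]) (use that in blast)
    then have "bary (verts ?K) v x = bary (verts K) v x"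
      using that by (intro bary_consistent) auto
    moreover have "x \<in> \<Union>T" using that by blast
    ultimately show ?thesis by (simp only: f_def if_True)
  qed
  have "continuous_on (\<Union>K\<in>T. K) f"
  proof (rule continuous_on_closed_Union[OF mesh_finite])
    fix K assume K: "K \<in> T"
    show "closed K" using elem_compact[OF K] by (rule compact_imp_closed)
    show "continuous_on K f"
      using f[OF K] by (simp add: continuous_on_bary cong: continuous_on_cong)
  qed
  moreover have "\<exists>a b. \<forall>x\<in>K. f x = a \<bullet> x + b" if "K \<in> T" for K
    using f[OF that] bary_affine_form[of "verts K" v] by auto
  ultimately have fe: "f \<in> fe_space T" by (simp add: fe_space_def)
  have nodal: "f w = (if w = v then 1 else 0)" if "w \<in> mesh_vertices T" for w
  proof -
    from that obtain K where K: "K \<in> T" "w \<in> verts K"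
      unfolding mesh_vertices_def verts_def by blast
    then show ?thesis
      using f[of K w] verts_subset[OF K(1)] bary_vertex[OF elem_verts[OF K(1)] K(2)] by auto
  qed
  have "?P f" using fe nodal by (auto simp: f_def)
  moreover have "g = f" if g: "?P g" for g
  proof
    fix x
    show "g x = f x"
    proof (cases "x \<in> \<Union>T")
      case True
      then obtain K where K: "K \<in> T" "x \<in> K" by blast
      then obtain a b where ab: "\<And>y. y \<in> K \<Longrightarrow> g y = a \<bullet> y + b"
        using g by (auto simp: fe_space_def)
      have "a \<bullet> w + b = (if w = v then 1 else 0)" if w: "w \<in> verts K" for w
      proof -
        have "w \<in> mesh_vertices T" using w K(1) by (auto simp: mesh_vertices_def verts_def)
        then show ?thesis using g ab[of w] verts_subset[OF K(1)] w by auto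
      qed
      from bary_unique(2)[OF elem_verts[OF K(1)] this] show ?thesis
        using ab f K by auto
    next
      case False
      then show ?thesis using g by (simp add: f_def)
    qed
  qed
  ultimately have "hat T v = f" unfolding hat_def by (rule the_equality)
  then show ?thesis using f[OF K x] by simp
qed

lemma grad_hat:
  assumes K: "K \<in> T" and x: "x \<in> interior K"
  shows "grad (hat T v) x = bary_grad (verts K) v"
proof -
  obtain b where b: "\<And>x. bary (verts K) v x = bary_grad (verts K) v \<bullet> x + b"
    using bary_affine_form by blast
  have "((\<lambda>y. bary_grad (verts K) v \<bullet> y + b) has_derivative (\<lambda>h. h \<bullet> bary_grad (verts K) v)) (at x)"
    by (auto intro!: derivative_eq_intros simp: inner_commute)
  then have "(hat T v has_derivative (\<lambda>h. h \<bullet> bary_grad (verts K) v)) (at x)"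
  proof (rule has_derivative_transform_within_open[OF _ open_interior x])
    fix y assume "y \<in> interior K"
    then show "bary_grad (verts K) v \<bullet> y + b = hat T v y"
      using hat_eq_bary[OF K] b interior_subset by (metis subsetD)
  qed
  then have G: "GDERIV (hat T v) x :> bary_grad (verts K) v" by (simp add: gderiv_def)
  show ?thesis unfolding grad_def
  proof (rule the_equality)
    show "GDERIV (hat T v) x :> bary_grad (verts K) v" by (rule G)
    fix g assume "GDERIV (hat T v) x :> g"
    then have "(\<lambda>h. h \<bullet> g) = (\<lambda>h. h \<bullet> bary_grad (verts K) v)"
      using G has_derivative_unique unfolding gderiv_def by blast
    then have "(g - bary_grad (verts K) v) \<bullet> (g - bary_grad (verts K) v) = 0"
      by (metis inner_diff_right cancel_comm_monoid_add_class.diff_cancel)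
    then show "g = bary_grad (verts K) v" by simp
  qed
qed

text \<open>
  Distinct elements meet in a proper face of one of them, which has lower dimension and is thus
  negligible.
\<close>

lemma has_integral_over_mesh:
  fixes f :: "real^'n \<Rightarrow> 'b::banach"
  assumes domain: "polyhedral_domain \<Omega>" and f: "\<And>K. K \<in> T \<Longrightarrow> (f has_integral i K) K"
  shows "(f has_integral (\<Sum>K\<in>T. i K)) \<Omega>"
proof -
  have "pairwise (\<lambda>K K'. negligible (K \<inter> K')) T"
  proof (rule pairwiseI)
    fix K K' assume KK: "K \<in> T" "K' \<in> T" "K \<noteq> K'"
    then have face: "(K \<inter> K') face_of K" "(K' \<inter> K) face_of K'"
      using mesh by (auto simp: simplicial_mesh_def triangulation_def)
    have dim: "aff_dim L = int CARD('n)" if "L \<in> T" for L using aff_dim_simplex elem_simplex that by blast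
    have "aff_dim (K \<inter> K') < int CARD('n)"
    proof (cases "K \<inter> K' = K")
      case True
      then have "K' \<inter> K \<noteq> K'" using KK(3) by blast
      then show ?thesis
        using face_of_aff_dim_lt[OF elem_convex[OF KK(2)] face(2)] dim[OF KK(2)] by (simp add: Int_commute)
    next
      case False
      then show ?thesis using face_of_aff_dim_lt[OF elem_convex[OF KK(1)] face(1)] dim[OF KK(1)] by simp
    qed
    then have "interior (K \<inter> K') = {}" by (intro low_dim_interior) simp
    then show "negligible (K \<inter> K')"
      using elem_convex KK by (simp add: negligible_convex_interior convex_Int)
  qed
  then have "(f has_integral (\<Sum>K\<in>T. i K)) (\<Union>T)"
    using f mesh_finite by (intro has_integral_Union) auto
  moreover have "negligible (frontier \<Omega>)" by (rule negligible_frontier_polyhedral[OF domain])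
  ultimately show ?thesis
    using has_integral_spike_set_eq[of \<Omega> "closure \<Omega>" f] closure_subset[of \<Omega>] domain
    by (auto intro: negligible_subset simp: mesh_Union frontier_def polyhedral_domain_def interior_open)
qed

end


section \<open>Matrix entries as sums over elements\<close>

context
  fixes \<Omega> :: "(real^'n) set" and T
  assumes mesh: "simplicial_mesh \<Omega> T" and domain: "polyhedral_domain \<Omega>"
begin

text \<open>
  The diffusion matrix is only controlled on the open domain, whereas elements may touch the
  boundary.
\<close>

lemma has_integral_elem_inside:
  fixes f :: "real^'n \<Rightarrow> 'b::banach"
  assumes "K \<in> T"
  shows "(f has_integral y) K \<longleftrightarrow> (f has_integral y) (K \<inter> \<Omega>)"
proof (rule has_integral_spike_set_eq)
  have "K \<subseteq> closure \<Omega>" using mesh_Union[OF mesh] assms by blast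
  then have "K - K \<inter> \<Omega> \<subseteq> frontier \<Omega>"
    using domain by (auto simp: frontier_def polyhedral_domain_def interior_open)
  then show "negligible {x \<in> K - K \<inter> \<Omega>. f x \<noteq> 0}"
    using negligible_frontier_polyhedral[OF domain] by (auto intro: negligible_subset)
  show "negligible {x \<in> K \<inter> \<Omega> - K. f x \<noteq> 0}"
    by (rule negligible_subset[OF negligible_empty]) auto
qed

context
  fixes D :: "real^'n \<Rightarrow> real^'n^'n"
  assumes diffusion: "diffusion_matrix \<Omega> D"
begin

lemma diffusion_has_integral:
  assumes K: "K \<in> T"
  shows "(D has_integral (integral K D)) K"
proof -
  have "K \<inter> \<Omega> \<in> sets lebesgue"
    using elem_compact[OF mesh K] domain
    by (intro sets.Int) (auto simp: polyhedral_domain_def compact_imp_closed)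
  then have "D absolutely_integrable_on (K \<inter> \<Omega>)"
    using diffusion by (auto simp: diffusion_matrix_def intro: set_integrable_subset)
  then have "D integrable_on (K \<inter> \<Omega>)" by (rule set_lebesgue_integral_eq_integral(1))
  then obtain y where "(D has_integral y) (K \<inter> \<Omega>)" by blast
  then have "(D has_integral y) K" by (rule iffD2[OF has_integral_elem_inside[OF K]])
  then have "D integrable_on K" by blast
  then show ?thesis by (rule integrable_integral)
qed

lemma diffusion_form_has_integral:
  assumes K: "K \<in> T"
  shows "((\<lambda>x. \<xi> \<bullet> (D x *v \<eta>)) has_integral (vol K * (\<xi> \<bullet> (elem_avg D K *v \<eta>)))) K"
proof -
  let ?h = "\<lambda>A :: real^'n^'n. \<xi> \<bullet> (A *v \<eta>)"
  have "linear ?h"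
    by (rule linearI) (simp_all add: matrix_vector_mult_add_rdistrib inner_add_right
        scaleR_matrix_vector_assoc[symmetric])
  then have "bounded_linear ?h" by (simp add: linear_conv_bounded_linear)
  from has_integral_linear[OF diffusion_has_integral[OF K] this]
  have "((\<lambda>x. \<xi> \<bullet> (D x *v \<eta>)) has_integral ?h (integral K D)) K" by (simp add: o_def)
  moreover have "?h (integral K D) = vol K * ?h (elem_avg D K)"
    using elem_vol_pos[OF mesh K] by (simp add: elem_avg_def scaleR_matrix_vector_assoc[symmetric])
  ultimately show ?thesis by simp
qed

lemma elem_avg_positive_definite:
  assumes K: "K \<in> T" and "\<xi> \<noteq> 0"
  shows "0 < \<xi> \<bullet> (elem_avg D K *v \<xi>)"
proof -
  obtain c where c: "0 < c" "\<And>x \<xi>. x \<in> \<Omega> \<Longrightarrow> c * (norm \<xi>)\<^sup>2 \<le> \<xi> \<bullet> (D x *v \<xi>)"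
    using diffusion unfolding diffusion_matrix_def by blast
  have "((\<lambda>x. 1) has_integral vol K) K"
    using lmeasurable_compact[OF elem_compact[OF mesh K]]
    by (simp add: has_integral_iff lmeasurable_iff_integrable_on lmeasure_integral vol_def)
  then have "((\<lambda>x. c * (norm \<xi>)\<^sup>2) has_integral c * (norm \<xi>)\<^sup>2 * vol K) K"
    using has_integral_mult_right[of "\<lambda>x. 1" "vol K" K "c * (norm \<xi>)\<^sup>2"] by simp
  from has_integral_le[OF iffD1[OF has_integral_elem_inside[OF K] this]
      iffD1[OF has_integral_elem_inside[OF K] diffusion_form_has_integral[OF K, of \<xi> \<xi>]]]
  have "c * (norm \<xi>)\<^sup>2 * vol K \<le> vol K * (\<xi> \<bullet> (elem_avg D K *v \<xi>))"
    using c(2) by simp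
  then have "c * (norm \<xi>)\<^sup>2 \<le> \<xi> \<bullet> (elem_avg D K *v \<xi>)"
    using elem_vol_pos[OF mesh K] by (simp add: mult.commute)
  moreover have "0 < c * (norm \<xi>)\<^sup>2" using c(1) assms(2) by simp
  ultimately show ?thesis by linarith
qed

lemma elem_avg_form_nonneg:
  assumes K: "K \<in> T"
  shows "0 \<le> \<xi> \<bullet> (elem_avg D K *v \<xi>)"
  using elem_avg_positive_definite[OF K, of \<xi>] by (cases "\<xi> = 0") auto

lemma elem_avg_symmetric:
  assumes K: "K \<in> T"
  shows "\<xi> \<bullet> (elem_avg D K *v \<eta>) = \<eta> \<bullet> (elem_avg D K *v \<xi>)"
proof -
  have "((\<lambda>x. \<xi> \<bullet> (D x *v \<eta>)) has_integral (vol K * (\<eta> \<bullet> (elem_avg D K *v \<xi>)))) (K \<inter> \<Omega>)"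
  proof (rule has_integral_eq)
    show "((\<lambda>x. \<eta> \<bullet> (D x *v \<xi>)) has_integral (vol K * (\<eta> \<bullet> (elem_avg D K *v \<xi>)))) (K \<inter> \<Omega>)"
      by (rule iffD1[OF has_integral_elem_inside[OF K] diffusion_form_has_integral[OF K]])
    show "\<eta> \<bullet> (D x *v \<xi>) = \<xi> \<bullet> (D x *v \<eta>)" if "x \<in> K \<inter> \<Omega>" for x
      using diffusion that by (intro symmetric_inner_commute) (auto simp: diffusion_matrix_def)
  qed
  then have "((\<lambda>x. \<xi> \<bullet> (D x *v \<eta>)) has_integral (vol K * (\<eta> \<bullet> (elem_avg D K *v \<xi>)))) K"
    by (rule iffD2[OF has_integral_elem_inside[OF K]])
  from has_integral_unique[OF this diffusion_form_has_integral[OF K]] show ?thesis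
    using elem_vol_pos[OF mesh K] by simp
qed

text \<open>
  The gradients are constant inside each element, so integrating the diffusion matrix amounts to
  averaging it.
\<close>

lemma stiffness_entry:
  fixes p :: "'m::finite \<Rightarrow> real^'n"
  shows "stiffness_matrix \<Omega> D (\<lambda>i. hat T (p i)) $ i $ j =
    (\<Sum>K\<in>T. vol K * (bary_grad (verts K) (p i) \<bullet> (elem_avg D K *v bary_grad (verts K) (p j))))"
proof -
  have "((\<lambda>x. grad (hat T (p i)) x \<bullet> (D x *v grad (hat T (p j)) x)) has_integral
      vol K * (bary_grad (verts K) (p i) \<bullet> (elem_avg D K *v bary_grad (verts K) (p j)))) K"
    if K: "K \<in> T" for K
  proof (rule has_integral_spike[OF _ _ diffusion_form_has_integral[OF K]])
    show "negligible (frontier K)" using elem_convex[OF mesh K] by (rule negligible_convex_frontier)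
    fix x assume "x \<in> K - frontier K"
    then have "x \<in> interior K" using closure_subset by (auto simp: frontier_def)
    then show "grad (hat T (p i)) x \<bullet> (D x *v grad (hat T (p j)) x) =
        bary_grad (verts K) (p i) \<bullet> (D x *v bary_grad (verts K) (p j))"
      by (simp add: grad_hat[OF mesh K])
  qed
  from has_integral_over_mesh[OF mesh domain this] show ?thesis
    by (simp add: stiffness_matrix_def integral_unique)
qed

end

lemma hat_product_has_integral:
  "((\<lambda>x. hat T v x * hat T w x) has_integral
     (\<Sum>K\<in>T. integral K (\<lambda>x. bary (verts K) v x * bary (verts K) w x))) \<Omega>"
proof (rule has_integral_over_mesh[OF mesh domain])
  fix K assume K: "K \<in> T"
  have "(\<lambda>x. bary (verts K) v x * bary (verts K) w x) integrable_on convex hull verts K"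
    by (intro continuous_integrable_simplex[OF elem_verts[OF mesh K]] continuous_intros)
  then have "((\<lambda>x. bary (verts K) v x * bary (verts K) w x) has_integral
      integral K (\<lambda>x. bary (verts K) v x * bary (verts K) w x)) K"
    using elem_hull[OF mesh K] by (simp add: integrable_integral)
  then show "((\<lambda>x. hat T v x * hat T w x) has_integral
      integral K (\<lambda>x. bary (verts K) v x * bary (verts K) w x)) K"
    by (rule has_integral_eq[rotated]) (simp add: hat_eq_bary[OF mesh K])
qed

end


section \<open>Estimates for the form of a single element\<close>

lemma matrix_vector_mult_sum_right:
  fixes B :: "real^'n^'m"
  shows "B *v (\<Sum>v\<in>S. y v) = (\<Sum>v\<in>S. B *v y v)"
  by (rule linear_sum[OF matrix_vector_mul_linear])

text \<open>
  Sum the nonnegative values of the form at all differences \<open>y\<^sub>v - y\<^sub>w\<close>.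
\<close>

lemma quadratic_form_sum_le_card:
  fixes B :: "real^'n^'n" and y :: "'a \<Rightarrow> real^'n"
  assumes S: "finite S" and psd: "\<And>x. 0 \<le> x \<bullet> (B *v x)"
  shows "(\<Sum>v\<in>S. y v) \<bullet> (B *v (\<Sum>v\<in>S. y v)) \<le> real (card S) * (\<Sum>v\<in>S. y v \<bullet> (B *v y v))"
proof -
  let ?q = "\<lambda>v w. y v \<bullet> (B *v y w)"
  have "0 \<le> (\<Sum>v\<in>S. \<Sum>w\<in>S. (y v - y w) \<bullet> (B *v (y v - y w)))"
    by (intro sum_nonneg psd)
  also have "\<dots> = (\<Sum>v\<in>S. \<Sum>w\<in>S. ?q v v) + (\<Sum>v\<in>S. \<Sum>w\<in>S. ?q w w)
      - (\<Sum>v\<in>S. \<Sum>w\<in>S. ?q v w) - (\<Sum>v\<in>S. \<Sum>w\<in>S. ?q w v)"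
    by (simp add: matrix_vector_mult_diff_distrib inner_diff_left inner_diff_right
        sum.distrib sum_subtractf algebra_simps)
  also have "(\<Sum>v\<in>S. \<Sum>w\<in>S. ?q w v) = (\<Sum>v\<in>S. \<Sum>w\<in>S. ?q v w)" by (rule sum.swap)
  also have "(\<Sum>v\<in>S. \<Sum>w\<in>S. ?q v w) = (\<Sum>v\<in>S. y v) \<bullet> (B *v (\<Sum>v\<in>S. y v))"
    by (simp add: matrix_vector_mult_sum_right inner_sum_left inner_sum_right) (rule sum.swap)
  also have "(\<Sum>v\<in>S. \<Sum>w\<in>S. ?q v v) = real (card S) * (\<Sum>v\<in>S. ?q v v)"
    by (simp add: sum_distrib_left)
  also have "(\<Sum>v\<in>S. \<Sum>w\<in>S. ?q w w) = real (card S) * (\<Sum>v\<in>S. ?q v v)" by simp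
  finally show ?thesis by linarith
qed

text \<open>
  Because of the zero row and column sums, the form equals
  \<open>- 1/2 (\<Sum>v w. a\<^sub>v\<^sub>w (u\<^sub>v - u\<^sub>w)\<^sup>2)\<close>; estimating \<open>(u\<^sub>v - u\<^sub>w)\<^sup>2 \<le> 2 u\<^sub>v\<^sup>2 + 2 u\<^sub>w\<^sup>2\<close>
  off the diagonal and using the zero sums again leaves twice the diagonal.
\<close>

lemma quadratic_form_sum_le_two:
  fixes B :: "real^'n^'n" and g :: "'a \<Rightarrow> real^'n" and u :: "'a \<Rightarrow> real"
  assumes S: "finite S" and zero: "(\<Sum>v\<in>S. g v) = 0"
    and off: "\<And>v w. v \<in> S \<Longrightarrow> w \<in> S \<Longrightarrow> v \<noteq> w \<Longrightarrow> g v \<bullet> (B *v g w) \<le> 0"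
  shows "(\<Sum>v\<in>S. u v *\<^sub>R g v) \<bullet> (B *v (\<Sum>v\<in>S. u v *\<^sub>R g v))
    \<le> 2 * (\<Sum>v\<in>S. (u v)\<^sup>2 * (g v \<bullet> (B *v g v)))"
proof -
  let ?a = "\<lambda>v w. g v \<bullet> (B *v g w)"
  have row: "(\<Sum>w\<in>S. ?a v w) = 0" for v
    using zero by (simp flip: inner_sum_right matrix_vector_mult_sum_right)
  have col: "(\<Sum>v\<in>S. ?a v w) = 0" for w
    using zero by (simp flip: inner_sum_left)
  have "(\<Sum>v\<in>S. u v *\<^sub>R g v) \<bullet> (B *v (\<Sum>v\<in>S. u v *\<^sub>R g v)) = (\<Sum>v\<in>S. \<Sum>w\<in>S. u v * u w * ?a v w)"
    by (simp add: matrix_vector_mult_sum_right matrix_vector_mult_scaleR inner_sum_left inner_sum_right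
        sum_distrib_left) (subst sum.swap, simp add: mult_ac)
  also have "\<dots> \<le> (\<Sum>v\<in>S. \<Sum>w\<in>S. - ((u v)\<^sup>2 + (u w)\<^sup>2) / 2 * ?a v w + (if v = w then 2 * (u v)\<^sup>2 * ?a v v else 0))"
  proof (intro sum_mono)
    fix v w assume vw: "v \<in> S" "w \<in> S"
    show "u v * u w * ?a v w \<le> - ((u v)\<^sup>2 + (u w)\<^sup>2) / 2 * ?a v w + (if v = w then 2 * (u v)\<^sup>2 * ?a v v else 0)"
    proof (cases "v = w")
      case False
      \<comment> \<open>This is \<open>(u\<^sub>v - u\<^sub>w)\<^sup>2 \<le> 2 u\<^sub>v\<^sup>2 + 2 u\<^sub>w\<^sup>2\<close> times the nonnegative number \<open>- a\<^sub>v\<^sub>w\<close>.\<close>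
      have "0 \<le> (u v + u w)\<^sup>2 * (- ?a v w)" using off[OF vw False] by (intro mult_nonneg_nonneg) auto
      then show ?thesis using False by (simp add: power2_eq_square algebra_simps)
    qed (simp add: power2_eq_square)
  qed
  also have "\<dots> = - (\<Sum>v\<in>S. (u v)\<^sup>2 / 2 * (\<Sum>w\<in>S. ?a v w)) - (\<Sum>w\<in>S. (u w)\<^sup>2 / 2 * (\<Sum>v\<in>S. ?a v w))
      + (\<Sum>v\<in>S. 2 * (u v)\<^sup>2 * ?a v v)"
  proof -
    have "(\<Sum>v\<in>S. \<Sum>w\<in>S. - ((u v)\<^sup>2 + (u w)\<^sup>2) / 2 * ?a v w) =
        - (\<Sum>v\<in>S. \<Sum>w\<in>S. (u v)\<^sup>2 / 2 * ?a v w) - (\<Sum>v\<in>S. \<Sum>w\<in>S. (u w)\<^sup>2 / 2 * ?a v w)"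
      by (simp add: sum_negf[symmetric] sum_subtractf[symmetric] field_simps)
    also have "(\<Sum>v\<in>S. \<Sum>w\<in>S. (u w)\<^sup>2 / 2 * ?a v w) = (\<Sum>w\<in>S. \<Sum>v\<in>S. (u w)\<^sup>2 / 2 * ?a v w)"
      by (rule sum.swap)
    finally show ?thesis using S by (simp add: sum.distrib sum_distrib_left)
  qed
  finally show ?thesis using row col by (simp add: sum_distrib_left mult.assoc)
qed

lemma verts_affine_image:
  fixes L :: "real^'n \<Rightarrow> real^'n"
  assumes L: "linear L" "inj L" and F: "\<And>x. F x = L x + b"
  shows "verts (F ` S) = F ` verts S"
proof -
  have inj: "inj F" using L(2) by (simp add: F inj_def)
  have seg: "open_segment (F x) (F y) = F ` open_segment x y" for x y
  proof -
    have "open_segment (F x) (F y) = (\<lambda>z. b + z) ` open_segment (L x) (L y)"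
      using open_segment_translation[of b "L x" "L y"] by (simp add: F add.commute[of _ b])
    then show ?thesis
      by (simp add: open_segment_linear_image[OF L] image_image F add.commute)
  qed
  have ext: "F x extreme_point_of F ` S \<longleftrightarrow> x extreme_point_of S" for x
    using inj by (auto simp: extreme_point_of_def seg inj_image_mem_iff)
  have "verts (F ` S) \<subseteq> F ` S" by (auto simp: verts_def extreme_point_of_def)
  then show ?thesis using ext by (auto simp: verts_def)
qed

text \<open>
  By the chain rule the gradient on \<open>K\<close> is the inverse transposed Jacobian matrix applied to the
  gradient of the corresponding coordinate on the reference element, whose length is known.
\<close>

lemma bary_grad_form_le_metric_norm:
  fixes K Khat :: "(real^'n) set"
  assumes K: "int CARD('n) simplex K" and Khat: "reference_simplex Khat"
    and F: "affine_bijection F" "F ` Khat = K" and v: "v \<in> verts K"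
  shows "bary_grad (verts K) v \<bullet> (elem_avg D K *v bary_grad (verts K) v) \<le> C_grad CARD('n) * metric_norm D F K"
proof -
  obtain L b where L: "linear L" and Fx: "\<And>x. F x = L x + b"
    using F(1) unfolding affine_bijection_def by blast
  have "inj F" using F(1) by (simp add: affine_bijection_def bij_is_inj)
  then have injL: "inj L" by (simp add: inj_def Fx)
  have "(F has_derivative L) (at 0)"
    unfolding Fx[abs_def] using bounded_linear_imp_has_derivative L has_derivative_add_const
    by (metis linear_conv_bounded_linear)
  then have jac: "jac F = matrix L"
    unfolding jac_def jacobian_def by (simp add: frechet_derivative_at[symmetric])
  have Lv: "jac F *v x = L x" for x unfolding jac using L by simp
  have "inj ((*v) (jac F))" using injL by (simp add: Lv inj_def)
  then have "invertible (jac F)" using matrix_left_invertible_injective invertible_left_inverse by blast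
  note inv = matrix_inv_inverse[OF this]
  have Khat_simplex: "int CARD('n) simplex Khat" and vol: "vol Khat = 1"
    using Khat by (auto simp: reference_simplex_def)
  obtain l where l: "\<And>v w. v \<in> verts Khat \<Longrightarrow> w \<in> verts Khat \<Longrightarrow> v \<noteq> w \<Longrightarrow> dist v w = l"
  proof -
    obtain l where "\<forall>v w. v extreme_point_of Khat \<and> w extreme_point_of Khat \<and> v \<noteq> w \<longrightarrow> dist v w = l"
      using Khat by (auto simp: reference_simplex_def)
    then show ?thesis by (intro that) (simp add: verts_def)
  qed
  have image: "verts K = F ` verts Khat" using verts_affine_image[OF L injL Fx] F(2) by blast
  then obtain vh where vh: "vh \<in> verts Khat" "v = F vh" using v by blast
  let ?g = "bary_grad (verts K) v" and ?gh = "bary_grad (verts Khat) vh"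
  let ?P = "matrix_inv (jac F)"
  obtain \<beta> where \<beta>: "\<And>x. bary (verts K) v x = ?g \<bullet> x + \<beta>" using bary_affine_form by blast
  have "transpose (jac F) *v ?g = ?gh"
  proof (rule bary_unique(1)[OF simplex_verts(1)[OF Khat_simplex]])
    fix w assume w: "w \<in> verts Khat"
    have "(transpose (jac F) *v ?g) \<bullet> w + (?g \<bullet> b + \<beta>) = ?g \<bullet> F w + \<beta>"
      by (simp add: transpose_matrix_vector dot_lmul_matrix Lv Fx inner_add_right)
    also have "\<dots> = bary (verts K) v (F w)" by (simp add: \<beta>)
    also have "\<dots> = (if w = vh then 1 else 0)"
      using bary_vertex[OF simplex_verts(1)[OF K], of "F w" v] w image vh(2) \<open>inj F\<close> by (auto simp: inj_eq)
    finally show "(transpose (jac F) *v ?g) \<bullet> w + (?g \<bullet> b + \<beta>) = (if w = vh then 1 else 0)" .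
  qed
  then have "transpose ?P *v ?gh = transpose (jac F ** ?P) *v ?g"
    by (metis matrix_transpose_mul matrix_vector_mul_assoc)
  then have g: "?g = transpose ?P *v ?gh" by (simp add: inv transpose_mat)
  let ?B = "?P ** elem_avg D K ** transpose ?P"
  have "?g \<bullet> (elem_avg D K *v ?g) = ?gh \<bullet> (?B *v ?gh)"
    unfolding g by (simp add: transpose_matrix_vector dot_lmul_matrix flip: matrix_vector_mul_assoc)
  also have "\<dots> \<le> norm ?gh * norm (?B *v ?gh)" by (rule norm_cauchy_schwarz)
  also have "\<dots> \<le> norm ?gh * (spectral_norm ?B * norm ?gh)"
    unfolding spectral_norm_def by (intro mult_left_mono onorm matrix_vector_mul_bounded_linear) auto
  also have "\<dots> = (norm ?gh)\<^sup>2 * metric_norm D F K"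
    by (simp add: metric_norm_def power2_eq_square)
  also have "(norm ?gh)\<^sup>2 = C_grad CARD('n)"
    using norm_bary_grad_reference[OF simplex_verts(1)[OF Khat_simplex] vh(1) _ l] simplex_verts(2)[OF Khat_simplex] vol
    by simp
  finally show ?thesis .
qed

lemma metric_norm_nonneg: "0 \<le> metric_norm D F K"
  unfolding metric_norm_def spectral_norm_def
  by (rule onorm_pos_le[OF matrix_vector_mul_bounded_linear])

text \<open>
  Dirichlet vertices and other points not numbered by \<open>p\<close> receive the value 0, so sums over all
  vertices of an element can replace sums over the basis functions.
\<close>

definition nodal_value :: "('m::finite \<Rightarrow> 'a) \<Rightarrow> real^'m \<Rightarrow> 'a \<Rightarrow> real" where
  "nodal_value p x v = (\<Sum>i\<in>UNIV. if p i = v then x $ i else 0)"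

lemma nodal_sum:
  fixes f :: "'a \<Rightarrow> 'b::real_vector"
  assumes S: "finite S" and f: "\<And>v. v \<notin> S \<Longrightarrow> f v = 0"
  shows "(\<Sum>i\<in>UNIV. x $ i *\<^sub>R f (p i)) = (\<Sum>v\<in>S. nodal_value p x v *\<^sub>R f v)"
proof -
  have "(\<Sum>v\<in>S. nodal_value p x v *\<^sub>R f v) = (\<Sum>v\<in>S. \<Sum>i\<in>UNIV. if v = p i then x $ i *\<^sub>R f v else 0)"
    unfolding nodal_value_def scaleR_sum_left by (intro sum.cong) auto
  also have "\<dots> = (\<Sum>i\<in>UNIV. \<Sum>v\<in>S. if v = p i then x $ i *\<^sub>R f v else 0)" by (rule sum.swap)
  also have "\<dots> = (\<Sum>i\<in>UNIV. x $ i *\<^sub>R f (p i))"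
    using S f by (intro sum.cong) auto
  finally show ?thesis by simp
qed

lemma nodal_square_sum:
  assumes S: "finite S" and p: "inj p"
  shows "(\<Sum>v\<in>S. (nodal_value p x v)\<^sup>2) = (\<Sum>i\<in>UNIV. if p i \<in> S then (x $ i)\<^sup>2 else 0)"
proof -
  have sq: "(nodal_value p x v)\<^sup>2 = (\<Sum>i\<in>UNIV. if v = p i then (x $ i)\<^sup>2 else 0)" for v
  proof (cases "v \<in> range p")
    case True
    then obtain j where j: "v = p j" by blast
    have "(p i = v) = (i = j)" "(v = p i) = (i = j)" for i using j p by (auto simp: inj_eq)
    then show ?thesis by (simp add: nodal_value_def)
  next
    case False
    then have "(p i = v) = False" "(v = p i) = False" for i by auto
    then show ?thesis by (simp add: nodal_value_def)
  qed
  have "(\<Sum>v\<in>S. (nodal_value p x v)\<^sup>2) = (\<Sum>i\<in>UNIV. \<Sum>v\<in>S. if v = p i then (x $ i)\<^sup>2 else 0)"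
    unfolding sq by (rule sum.swap)
  also have "\<dots> = (\<Sum>i\<in>UNIV. if p i \<in> S then (x $ i)\<^sup>2 else 0)"
    using S by (intro sum.cong) auto
  finally show ?thesis .
qed

text \<open>
  Exchanging summation over elements and over their vertices turns element contributions into patch
  contributions.
\<close>

lemma sum_elements_eq_sum_patches:
  fixes h :: "(real^'n) set \<Rightarrow> real" and a :: "'m::finite \<Rightarrow> real"
  assumes T: "finite T"
  shows "(\<Sum>K\<in>T. h K * (\<Sum>i\<in>UNIV. if p i \<in> verts K then a i else 0)) =
    (\<Sum>i\<in>UNIV. a i * (\<Sum>K\<in>patch T (p i). h K))"
proof -
  have "(\<Sum>K\<in>T. h K * (\<Sum>i\<in>UNIV. if p i \<in> verts K then a i else 0)) =
      (\<Sum>K\<in>T. \<Sum>i\<in>UNIV. if p i \<in> verts K then a i * h K else 0)"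
    unfolding sum_distrib_left by (intro sum.cong) auto
  also have "\<dots> = (\<Sum>i\<in>UNIV. \<Sum>K\<in>T. if p i \<in> verts K then a i * h K else 0)" by (rule sum.swap)
  also have "\<dots> = (\<Sum>i\<in>UNIV. \<Sum>K\<in>patch T (p i). a i * h K)"
  proof (rule sum.cong[OF refl])
    fix i
    have "patch T (p i) = {K \<in> T. p i \<in> verts K}" by (auto simp: patch_def verts_def)
    then show "(\<Sum>K\<in>T. if p i \<in> verts K then a i * h K else 0) = (\<Sum>K\<in>patch T (p i). a i * h K)"
      using sum.inter_filter[OF T, of "\<lambda>K. a i * h K" "\<lambda>K. p i \<in> verts K"] by simp
  qed
  finally show ?thesis by (simp add: sum_distrib_left)
qed

lemma quadratic_form_expand:
  fixes M :: "real^'m^'m"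
  shows "x \<bullet> (M *v x) = (\<Sum>i\<in>UNIV. \<Sum>j\<in>UNIV. x $ i * x $ j * M $ i $ j)"
  by (simp add: inner_vec_def matrix_vector_mult_def sum_distrib_left mult_ac)


section \<open>Assembly over the mesh\<close>

text \<open>
  The only point where general and nonobtuse meshes differ: the local stiffness form of every element
  is at most \<open>c\<close> times its diagonal part.
\<close>

definition element_form_bound :: "(real^'n) set set \<Rightarrow> (real^'n \<Rightarrow> real^'n^'n) \<Rightarrow> real \<Rightarrow> bool" where
  "element_form_bound T D c \<longleftrightarrow> (\<forall>K\<in>T. \<forall>u.
     (\<Sum>v\<in>verts K. u v *\<^sub>R bary_grad (verts K) v) \<bullet> (elem_avg D K *v (\<Sum>v\<in>verts K. u v *\<^sub>R bary_grad (verts K) v))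
       \<le> c * (\<Sum>v\<in>verts K. (u v)\<^sup>2 * (bary_grad (verts K) v \<bullet> (elem_avg D K *v bary_grad (verts K) v))))"

context
  fixes \<Omega> :: "(real^'n) set" and T and p :: "'m::finite \<Rightarrow> real^'n"
  assumes mesh: "simplicial_mesh \<Omega> T" and domain: "polyhedral_domain \<Omega>"
begin

lemma mass_entry:
  "mass_matrix \<Omega> (\<lambda>i. hat T (p i)) $ i $ j =
    (\<Sum>K\<in>T. integral K (\<lambda>x. bary (verts K) (p i) x * bary (verts K) (p j) x))"
  unfolding mass_matrix_def using integral_unique[OF hat_product_has_integral[OF mesh domain]] by simp

lemma mass_symmetric: "transpose (mass_matrix \<Omega> \<phi>) = mass_matrix \<Omega> \<phi>"
  by (simp add: transpose_def mass_matrix_def vec_eq_iff mult.commute)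

lemma patch_vol_pos:
  assumes "p i \<in> mesh_vertices T"
  shows "0 < patch_vol T (p i)"
proof -
  obtain K where "K \<in> patch T (p i)" using assms by (auto simp: mesh_vertices_def patch_def)
  then show ?thesis
    unfolding patch_vol_def using mesh_finite[OF mesh] elem_vol_pos[OF mesh]
    by (intro sum_pos2[where i = K]) (auto simp: patch_def intro: less_imp_le)
qed

text \<open>
  The local mass form of each element dominates a multiple of the squares of the nodal values;
  collecting the elements around each vertex produces the patch volumes.
\<close>

lemma mass_form_lower_bound:
  assumes inj: "inj p"
  shows "1 / ((real CARD('n) + 1) * (real CARD('n) + 2)) * (\<Sum>i\<in>UNIV. (x $ i)\<^sup>2 * patch_vol T (p i))
    \<le> x \<bullet> (mass_matrix \<Omega> (\<lambda>i. hat T (p i)) *v x)"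
proof -
  let ?c = "1 / ((real CARD('n) + 1) * (real CARD('n) + 2))"
  let ?b = "\<lambda>K i. bary (verts K) (p i)"
  have int: "(\<lambda>y. ?b K i y * ?b K j y) integrable_on K" if "K \<in> T" for K i j
    using continuous_integrable_simplex[OF elem_verts[OF mesh that], of "\<lambda>y. ?b K i y * ?b K j y"]
    by (simp add: elem_hull[OF mesh that] continuous_on_mult continuous_on_bary)
  have "?c * (\<Sum>i\<in>UNIV. (x $ i)\<^sup>2 * patch_vol T (p i)) =
      ?c * (\<Sum>K\<in>T. vol K * (\<Sum>i\<in>UNIV. if p i \<in> verts K then (x $ i)\<^sup>2 else 0))"
    by (simp add: sum_elements_eq_sum_patches[OF mesh_finite[OF mesh]] patch_vol_def)
  also have "\<dots> = (\<Sum>K\<in>T. vol K * ?c * (\<Sum>v\<in>verts K. (nodal_value p x v)\<^sup>2))"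
    unfolding sum_distrib_left[of ?c]
    by (intro sum.cong) (simp_all add: nodal_square_sum[OF simplex_vertices_finite[OF elem_verts[OF mesh]] inj])
  also have "\<dots> \<le> (\<Sum>K\<in>T. integral K (\<lambda>y. (\<Sum>v\<in>verts K. nodal_value p x v * bary (verts K) v y)\<^sup>2))"
  proof (rule sum_mono)
    fix K assume K: "K \<in> T"
    show "vol K * ?c * (\<Sum>v\<in>verts K. (nodal_value p x v)\<^sup>2)
      \<le> integral K (\<lambda>y. (\<Sum>v\<in>verts K. nodal_value p x v * bary (verts K) v y)\<^sup>2)"
      using integral_square_lower_bound[OF elem_verts[OF mesh K], of "nodal_value p x"]
      by (simp add: elem_hull[OF mesh K])
  qed
  also have "\<dots> = (\<Sum>K\<in>T. \<Sum>i\<in>UNIV. \<Sum>j\<in>UNIV. x $ i * x $ j * integral K (\<lambda>y. ?b K i y * ?b K j y))"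
  proof (rule sum.cong)
    fix K assume K: "K \<in> T"
    have "(\<Sum>v\<in>verts K. nodal_value p x v * bary (verts K) v y) = (\<Sum>i\<in>UNIV. x $ i * ?b K i y)" for y
      using nodal_sum[OF simplex_vertices_finite[OF elem_verts[OF mesh K]], of "\<lambda>v. bary (verts K) v y" x p]
      by (simp add: bary_def)
    then have "integral K (\<lambda>y. (\<Sum>v\<in>verts K. nodal_value p x v * bary (verts K) v y)\<^sup>2) =
        integral K (\<lambda>y. \<Sum>i\<in>UNIV. \<Sum>j\<in>UNIV. x $ i * x $ j * (?b K i y * ?b K j y))"
      by (simp add: power2_eq_square sum_product mult_ac)
    also have "\<dots> = (\<Sum>i\<in>UNIV. integral K (\<lambda>y. \<Sum>j\<in>UNIV. x $ i * x $ j * (?b K i y * ?b K j y)))"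
      using int[OF K] by (intro integral_sum integrable_sum) (auto intro: integrable_on_mult_right)
    also have "\<dots> = (\<Sum>i\<in>UNIV. \<Sum>j\<in>UNIV. integral K (\<lambda>y. x $ i * x $ j * (?b K i y * ?b K j y)))"
      using int[OF K] by (intro sum.cong integral_sum) (auto intro: integrable_on_mult_right)
    finally show "integral K (\<lambda>y. (\<Sum>v\<in>verts K. nodal_value p x v * bary (verts K) v y)\<^sup>2) =
        (\<Sum>i\<in>UNIV. \<Sum>j\<in>UNIV. x $ i * x $ j * integral K (\<lambda>y. ?b K i y * ?b K j y))"
      by simp
  qed simp
  also have "\<dots> = x \<bullet> (mass_matrix \<Omega> (\<lambda>i. hat T (p i)) *v x)"
    unfolding quadratic_form_expand mass_entry sum_distrib_left
    by (subst sum.swap, rule sum.cong[OF refl], rule sum.swap)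
  finally show ?thesis .
qed

text \<open>
  The diagonal entry is a row sum of the full mass matrix, whose entries are nonnegative; its own
  diagonal entry already yields the factor 2.
\<close>

lemma lumped_mass_entry_lower_bound:
  "2 / ((real CARD('n) + 1) * (real CARD('n) + 2)) * patch_vol T (p i)
    \<le> lumped_mass_matrix \<Omega> (\<lambda>i. hat T (p i)) $ i $ i"
proof -
  let ?c = "1 / ((real CARD('n) + 1) * (real CARD('n) + 2))"
  let ?M = "mass_matrix \<Omega> (\<lambda>i. hat T (p i))"
  have nonneg: "0 \<le> ?M $ i $ j" for j
    unfolding mass_entry
  proof (intro sum_nonneg integral_nonneg)
    fix K assume K: "K \<in> T"
    show "(\<lambda>y. bary (verts K) (p i) y * bary (verts K) (p j) y) integrable_on K"
      using continuous_integrable_simplex[OF elem_verts[OF mesh K], of "\<lambda>y. bary (verts K) (p i) y * bary (verts K) (p j) y"]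
      by (simp add: elem_hull[OF mesh K] continuous_on_mult continuous_on_bary)
    fix y assume "y \<in> K"
    then show "0 \<le> bary (verts K) (p i) y * bary (verts K) (p j) y"
      using bary_nonneg[OF elem_verts[OF mesh K]] elem_hull[OF mesh K] by simp
  qed
  have "((\<lambda>x. \<Sum>j\<in>UNIV. hat T (p i) x * hat T (p j) x) has_integral (\<Sum>j\<in>UNIV. ?M $ i $ j)) \<Omega>"
    unfolding mass_entry by (intro has_integral_sum hat_product_has_integral[OF mesh domain]) simp
  then have lumped: "lumped_mass_matrix \<Omega> (\<lambda>i. hat T (p i)) $ i $ i = (\<Sum>j\<in>UNIV. ?M $ i $ j)"
    by (simp add: lumped_mass_matrix_def sum_distrib_left integral_unique)
  have "2 * ?c * patch_vol T (p i) = (\<Sum>K\<in>T. if p i \<in> verts K then 2 * ?c * vol K else 0)"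
  proof -
    have "patch T (p i) = {K \<in> T. p i \<in> verts K}" by (auto simp: patch_def verts_def)
    then show ?thesis
      unfolding patch_vol_def sum_distrib_left
      using sum.inter_filter[OF mesh_finite[OF mesh], of "\<lambda>K. 2 * ?c * vol K" "\<lambda>K. p i \<in> verts K"] by simp
  qed
  also have "\<dots> = ?M $ i $ i"
    unfolding mass_entry
  proof (rule sum.cong)
    fix K assume K: "K \<in> T"
    show "(if p i \<in> verts K then 2 * ?c * vol K else 0) =
        integral K (\<lambda>y. bary (verts K) (p i) y * bary (verts K) (p i) y)"
      using integral_bary_product[OF elem_verts[OF mesh K], of "p i" "p i"]
      by (auto simp: elem_hull[OF mesh K] bary_def)
  qed simp
  also have "\<dots> \<le> (\<Sum>j\<in>UNIV. ?M $ i $ j)" using nonneg by (intro member_le_sum) auto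
  finally show ?thesis by (simp add: lumped)
qed

lemma lumped_mass_form_lower_bound:
  "2 / ((real CARD('n) + 1) * (real CARD('n) + 2)) * (\<Sum>i\<in>UNIV. (x $ i)\<^sup>2 * patch_vol T (p i))
    \<le> x \<bullet> (lumped_mass_matrix \<Omega> (\<lambda>i. hat T (p i)) *v x)"
proof -
  let ?M = "lumped_mass_matrix \<Omega> (\<lambda>i. hat T (p i))"
  have "x \<bullet> (?M *v x) = (\<Sum>i\<in>UNIV. \<Sum>j\<in>UNIV. if i = j then (x $ i)\<^sup>2 * ?M $ i $ i else 0)"
    unfolding quadratic_form_expand
    by (intro sum.cong) (auto simp: lumped_mass_matrix_def power2_eq_square)
  also have "\<dots> = (\<Sum>i\<in>UNIV. (x $ i)\<^sup>2 * ?M $ i $ i)" by simp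
  also have "\<dots> \<ge> (\<Sum>i\<in>UNIV. (x $ i)\<^sup>2 * (2 / ((real CARD('n) + 1) * (real CARD('n) + 2)) * patch_vol T (p i)))"
    by (intro sum_mono mult_left_mono lumped_mass_entry_lower_bound) simp
  also have "(\<Sum>i\<in>UNIV. (x $ i)\<^sup>2 * (2 / ((real CARD('n) + 1) * (real CARD('n) + 2)) * patch_vol T (p i))) =
      2 / ((real CARD('n) + 1) * (real CARD('n) + 2)) * (\<Sum>i\<in>UNIV. (x $ i)\<^sup>2 * patch_vol T (p i))"
    by (simp only: sum_distrib_left mult.left_commute)
  finally show ?thesis .
qed

context
  fixes D :: "real^'n \<Rightarrow> real^'n^'n"
  assumes diffusion: "diffusion_matrix \<Omega> D"
begin

lemma stiffness_symmetric:
  "transpose (stiffness_matrix \<Omega> D (\<lambda>i. hat T (p i))) = stiffness_matrix \<Omega> D (\<lambda>i. hat T (p i))"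
proof -
  have "stiffness_matrix \<Omega> D (\<lambda>i. hat T (p i)) $ j $ i = stiffness_matrix \<Omega> D (\<lambda>i. hat T (p i)) $ i $ j" for i j
    unfolding stiffness_entry[OF mesh domain diffusion]
    by (intro sum.cong arg_cong2[of _ _ _ _ "(*)"] elem_avg_symmetric[OF mesh domain diffusion]) auto
  then show ?thesis by (simp add: transpose_def vec_eq_iff)
qed

text \<open>
  The same bookkeeping as for the mass form, with the element volumes weighted by the local norms.
\<close>

lemma stiffness_form_upper_bound:
  assumes inj: "inj p" and Khat: "reference_simplex Khat"
    and F: "\<And>K. K \<in> T \<Longrightarrow> affine_bijection (F K) \<and> F K ` Khat = K"
    and c: "0 \<le> c"
    and element_bound: "element_form_bound T D c"
  shows "x \<bullet> (stiffness_matrix \<Omega> D (\<lambda>i. hat T (p i)) *v x)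
    \<le> c * C_grad CARD('n) * (\<Sum>i\<in>UNIV. (x $ i)\<^sup>2 * (\<Sum>K\<in>patch T (p i). vol K * metric_norm D (F K) K))"
proof -
  let ?E = "elem_avg D" and ?g = "\<lambda>K. bary_grad (verts K)" and ?m = "\<lambda>K. metric_norm D (F K) K"
  let ?G = "\<lambda>K. \<Sum>i\<in>UNIV. x $ i *\<^sub>R ?g K (p i)"
  have "x \<bullet> (stiffness_matrix \<Omega> D (\<lambda>i. hat T (p i)) *v x) =
      (\<Sum>i\<in>UNIV. \<Sum>j\<in>UNIV. \<Sum>K\<in>T. x $ i * x $ j * (vol K * (?g K (p i) \<bullet> (?E K *v ?g K (p j)))))"
    unfolding quadratic_form_expand stiffness_entry[OF mesh domain diffusion] sum_distrib_left by simp
  also have "\<dots> = (\<Sum>K\<in>T. \<Sum>i\<in>UNIV. \<Sum>j\<in>UNIV. x $ i * x $ j * (vol K * (?g K (p i) \<bullet> (?E K *v ?g K (p j)))))"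
    by (rule trans[OF sum.cong[OF refl sum.swap] sum.swap])
  also have "\<dots> = (\<Sum>K\<in>T. vol K * (?G K \<bullet> (?E K *v ?G K)))"
  proof (rule sum.cong[OF refl])
    fix K
    have "?G K \<bullet> (?E K *v ?G K) = (\<Sum>i\<in>UNIV. \<Sum>j\<in>UNIV. x $ i * x $ j * (?g K (p i) \<bullet> (?E K *v ?g K (p j))))"
      unfolding inner_sum_left inner_scaleR_left matrix_vector_mult_sum_right matrix_vector_mult_scaleR
        inner_sum_right inner_scaleR_right sum_distrib_left
      by (subst sum.swap) (simp add: mult_ac)
    then show "(\<Sum>i\<in>UNIV. \<Sum>j\<in>UNIV. x $ i * x $ j * (vol K * (?g K (p i) \<bullet> (?E K *v ?g K (p j))))) =
        vol K * (?G K \<bullet> (?E K *v ?G K))"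
      by (simp add: sum_distrib_left mult_ac)
  qed
  also have "\<dots> \<le> (\<Sum>K\<in>T. vol K * (c * (C_grad CARD('n) * ?m K * (\<Sum>v\<in>verts K. (nodal_value p x v)\<^sup>2))))"
  proof (intro sum_mono mult_left_mono)
    fix K assume K: "K \<in> T"
    have "?G K = (\<Sum>v\<in>verts K. nodal_value p x v *\<^sub>R ?g K v)"
      by (rule nodal_sum[OF simplex_vertices_finite[OF elem_verts[OF mesh K]]]) (simp add: bary_grad_def)
    then have "?G K \<bullet> (?E K *v ?G K) \<le> c * (\<Sum>v\<in>verts K. (nodal_value p x v)\<^sup>2 * (?g K v \<bullet> (?E K *v ?g K v)))"
      using element_bound K by (simp add: element_form_bound_def)
    also have "\<dots> \<le> c * (\<Sum>v\<in>verts K. (nodal_value p x v)\<^sup>2 * (C_grad CARD('n) * ?m K))"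
      using F[OF K] c by (intro mult_left_mono sum_mono bary_grad_form_le_metric_norm[OF elem_simplex[OF mesh K] Khat]) auto
    also have "\<dots> = c * (C_grad CARD('n) * ?m K * (\<Sum>v\<in>verts K. (nodal_value p x v)\<^sup>2))"
      by (simp add: sum_distrib_left mult_ac)
    finally show "?G K \<bullet> (?E K *v ?G K) \<le> \<dots>" .
    show "0 \<le> vol K" by (simp add: vol_def)
  qed
  also have "\<dots> = c * C_grad CARD('n) *
      (\<Sum>K\<in>T. vol K * ?m K * (\<Sum>i\<in>UNIV. if p i \<in> verts K then (x $ i)\<^sup>2 else 0))"
    unfolding sum_distrib_left[of "c * C_grad CARD('n)"]
    by (intro sum.cong)
       (simp_all add: nodal_square_sum[OF simplex_vertices_finite[OF elem_verts[OF mesh]] inj] mult_ac)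
  also have "\<dots> = c * C_grad CARD('n) * (\<Sum>i\<in>UNIV. (x $ i)\<^sup>2 * (\<Sum>K\<in>patch T (p i). vol K * ?m K))"
    by (simp only: sum_elements_eq_sum_patches[OF mesh_finite[OF mesh]])
  finally show ?thesis .
qed

end
end

lemma element_form_bound_general:
  fixes \<Omega> :: "(real^'n) set"
  assumes mesh: "simplicial_mesh \<Omega> T" and domain: "polyhedral_domain \<Omega>"
    and diffusion: "diffusion_matrix \<Omega> D"
  shows "element_form_bound T D (real CARD('n) + 1)"
  unfolding element_form_bound_def
proof (intro ballI allI)
  fix K and u :: "real^'n \<Rightarrow> real"
  assume K: "K \<in> T"
  have S: "simplex_vertices (verts K)" by (rule elem_verts[OF mesh K])
  then have card: "real (card (verts K)) = real CARD('n) + 1" by (simp add: simplex_vertices_def)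
  show "(\<Sum>v\<in>verts K. u v *\<^sub>R bary_grad (verts K) v) \<bullet> (elem_avg D K *v (\<Sum>v\<in>verts K. u v *\<^sub>R bary_grad (verts K) v))
      \<le> (real CARD('n) + 1) * (\<Sum>v\<in>verts K. (u v)\<^sup>2 * (bary_grad (verts K) v \<bullet> (elem_avg D K *v bary_grad (verts K) v)))"
    using quadratic_form_sum_le_card[OF simplex_vertices_finite[OF S] elem_avg_form_nonneg[OF mesh domain diffusion K],
        of "\<lambda>v. u v *\<^sub>R bary_grad (verts K) v"]
    by (simp add: card matrix_vector_mult_scaleR power2_eq_square mult.assoc)
qed

text \<open>
  At an interior point of an element the condition on the hat functions becomes one on the
  gradients of the barycentric coordinates.
\<close>

lemma element_form_bound_nonobtuse:
  fixes \<Omega> :: "(real^'n) set"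
  assumes mesh: "simplicial_mesh \<Omega> T" and nonobtuse: "nonobtuse T D"
  shows "element_form_bound T D 2"
  unfolding element_form_bound_def
proof (intro ballI allI quadratic_form_sum_le_two)
  fix K assume K: "K \<in> T"
  have S: "simplex_vertices (verts K)" by (rule elem_verts[OF mesh K])
  then show "finite (verts K)" "(\<Sum>v\<in>verts K. bary_grad (verts K) v) = 0"
    by (rule simplex_vertices_finite, rule sum_bary_grad)
  have "\<not> negligible K" using simplex_not_negligible[OF S] elem_hull[OF mesh K] by simp
  then obtain x where x: "x \<in> interior K"
    using negligible_convex_interior[OF elem_convex[OF mesh K]] by blast
  fix v w assume "v \<in> verts K" "w \<in> verts K" "v \<noteq> w"
  then have "grad (hat T v) x \<bullet> (elem_avg D K *v grad (hat T w) x) \<le> 0"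
    using nonobtuse K x unfolding nonobtuse_def verts_def by blast
  then show "bary_grad (verts K) v \<bullet> (elem_avg D K *v bary_grad (verts K) w) \<le> 0"
    by (simp add: grad_hat[OF mesh K x])
qed

text \<open>
  Each averaged diffusion matrix is positive definite, hence nonsingular, so every element has
  positive metric volume.  This allows cancelling the powers of the mesh size.
\<close>

lemma metric_h_pos:
  fixes \<Omega> :: "(real^'n) set"
  assumes mesh: "simplicial_mesh \<Omega> T" and domain: "polyhedral_domain \<Omega>"
    and diffusion: "diffusion_matrix \<Omega> D"
  shows "0 < metric_h T D"
proof -
  have "closure \<Omega> \<noteq> {}" using domain by (simp add: polyhedral_domain_def)
  then have "T \<noteq> {}" using mesh_Union[OF mesh] by (metis Union_empty)
  have "0 < metric_vol D K" if K: "K \<in> T" for K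
  proof -
    have "inj ((*v) (elem_avg D K))"
    proof (rule injI)
      fix x y assume "elem_avg D K *v x = elem_avg D K *v y"
      then have "(x - y) \<bullet> (elem_avg D K *v (x - y)) = 0" by (simp add: matrix_vector_mult_diff_distrib)
      then show "x = y" using elem_avg_positive_definite[OF mesh domain diffusion K, of "x - y"] by force
    qed
    then have "det (elem_avg D K) \<noteq> 0"
      using matrix_left_invertible_injective invertible_left_inverse invertible_det_nz by blast
    then show ?thesis using elem_vol_pos[OF mesh K] by (simp add: metric_vol_def)
  qed
  then have "0 < (\<Sum>K\<in>T. metric_vol D K)" using mesh_finite[OF mesh] \<open>T \<noteq> {}\<close> by (intro sum_pos) auto
  then have "0 < 1 / real (card T) * (\<Sum>K\<in>T. metric_vol D K)"
    using mesh_finite[OF mesh] \<open>T \<noteq> {}\<close> by (simp add: card_gt_0_iff)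
  then show ?thesis unfolding metric_h_def powr_gt_zero by linarith
qed

theorem corollary3p3p1:
  fixes \<Omega> \<Gamma>D \<Gamma>N :: "(real^'n) set"
    and D :: "real^'n \<Rightarrow> real^'n^'n"
    and T :: "(real^'n) set set"
    and p :: "'m::finite \<Rightarrow> real^'n"
    and \<phi> :: "'m \<Rightarrow> real^'n \<Rightarrow> real"
    and Khat :: "(real^'n) set"
    and F :: "(real^'n) set \<Rightarrow> real^'n \<Rightarrow> real^'n"
    and A Mt :: "real^'m^'m"
    and Cstar :: real
  assumes domain: "polyhedral_domain \<Omega>"
    and boundary: "frontier \<Omega> = \<Gamma>D \<union> \<Gamma>N"
    and diffusion: "diffusion_matrix \<Omega> D"
    and mesh: "simplicial_mesh \<Omega> T"
    and dirichlet: "dirichlet_part T \<Gamma>D"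
    and numbering: "bij_betw p (UNIV :: 'm set) {v \<in> mesh_vertices T. v \<notin> \<Gamma>D}"
    and basis: "\<And>i. \<phi> i = hat T (p i)"
    and reference: "reference_simplex Khat"
    and maps: "\<And>K. K \<in> T \<Longrightarrow> affine_bijection (F K) \<and> F K ` Khat = K"
    and stiffness: "A = stiffness_matrix \<Omega> D \<phi>"
    and choice:
      "(Mt = mass_matrix \<Omega> \<phi> \<and> Cstar = 2 * (real CARD('n) + 1)) \<or>
       (Mt = lumped_mass_matrix \<Omega> \<phi> \<and> Cstar = real CARD('n) + 1) \<or>
       (nonobtuse T D \<and> Mt = mass_matrix \<Omega> \<phi> \<and> Cstar = 4) \<or>
       (nonobtuse T D \<and> Mt = lumped_mass_matrix \<Omega> \<phi> \<and> Cstar = 2)"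
  shows "lambda_max (matrix_inv Mt ** A)
           \<le> Cstar * C_sharp CARD('n) *
             Max (range (\<lambda>i. \<Sum>K\<in>patch T (p i). vol K / patch_vol T (p i) * metric_norm D (F K) K))
       \<and> Cstar * C_sharp CARD('n) *
             Max (range (\<lambda>i. \<Sum>K\<in>patch T (p i). vol K / patch_vol T (p i) * metric_norm D (F K) K))
         = Cstar * C_sharp CARD('n) * inverse ((metric_h T D)\<^sup>2) *
             Max (range (\<lambda>i. \<Sum>K\<in>patch T (p i). vol K / patch_vol T (p i) * quality T D (F K) K))"
proof
  let ?d = "real CARD('n)"
  let ?S = "\<lambda>i. \<Sum>K\<in>patch T (p i). vol K / patch_vol T (p i) * metric_norm D (F K) K"
  let ?R = "Max (range ?S)"
  let ?W = "\<lambda>x :: real^'m. \<Sum>i\<in>UNIV. (x $ i)\<^sup>2 * patch_vol T (p i)"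
  have \<phi>: "\<phi> = (\<lambda>i. hat T (p i))" using basis by (rule ext)
  have inj: "inj p" using numbering by (simp add: bij_betw_def)
  have "p i \<in> mesh_vertices T" for i using numbering by (auto simp: bij_betw_def)
  then have \<omega>: "0 < patch_vol T (p i)" for i by (rule patch_vol_pos[OF mesh domain])
  have S_nonneg: "0 \<le> ?S i" for i
    using \<omega>[of i] by (intro sum_nonneg mult_nonneg_nonneg metric_norm_nonneg divide_nonneg_pos) (auto simp: vol_def)
  have S_le: "?S i \<le> ?R" for i by (intro Max_ge) auto
  have R: "0 \<le> ?R" using S_nonneg S_le order_trans by blast
  have Cg: "0 \<le> C_grad CARD('n)" by (simp add: C_grad_def)
  have C_sharp: "C_sharp CARD('n) = C_grad CARD('n) * ((?d + 1) * (?d + 2)) / 2"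
    by (simp add: C_sharp_def)

  \<comment> \<open>The four cases differ only in the constants \<open>c\<close> (stiffness side) and \<open>k\<close> (mass side).\<close>
  have constants: "\<exists>c k. 0 \<le> c \<and> 0 < k \<and> Cstar = 2 * c / k \<and>
      (\<forall>x. k / ((?d + 1) * (?d + 2)) * ?W x \<le> x \<bullet> (Mt *v x)) \<and> element_form_bound T D c"
    using choice
  proof (elim disjE conjE)
    assume "Mt = mass_matrix \<Omega> \<phi>" "Cstar = 2 * (?d + 1)"
    then show ?thesis
      using mass_form_lower_bound[OF mesh domain inj] element_form_bound_general[OF mesh domain diffusion]
      by - (rule exI[of _ "?d + 1"], rule exI[of _ 1], simp add: \<phi>)
  next
    assume "Mt = lumped_mass_matrix \<Omega> \<phi>" "Cstar = ?d + 1"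
    then show ?thesis
      using lumped_mass_form_lower_bound[OF mesh domain, where p = p] element_form_bound_general[OF mesh domain diffusion]
      by - (rule exI[of _ "?d + 1"], rule exI[of _ 2], simp add: \<phi>)
  next
    assume "nonobtuse T D" "Mt = mass_matrix \<Omega> \<phi>" "Cstar = 4"
    then show ?thesis
      using mass_form_lower_bound[OF mesh domain inj] element_form_bound_nonobtuse[OF mesh]
      by - (rule exI[of _ 2], rule exI[of _ 1], simp add: \<phi>)
  next
    assume "nonobtuse T D" "Mt = lumped_mass_matrix \<Omega> \<phi>" "Cstar = 2"
    then show ?thesis
      using lumped_mass_form_lower_bound[OF mesh domain, where p = p] element_form_bound_nonobtuse[OF mesh]
      by - (rule exI[of _ 2], rule exI[of _ 2], simp add: \<phi>)
  qed
  then obtain c k where c: "0 \<le> c" and k: "0 < k" and Cstar: "Cstar = 2 * c / k"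
    and mass: "\<And>x. k / ((?d + 1) * (?d + 2)) * ?W x \<le> x \<bullet> (Mt *v x)"
    and loc: "element_form_bound T D c"
    by blast
  show "lambda_max (matrix_inv Mt ** A) \<le> Cstar * C_sharp CARD('n) * ?R"
  proof (rule lambda_max_le)
    show "transpose A = A"
      unfolding stiffness \<phi> by (rule stiffness_symmetric[OF mesh domain diffusion])
    have "transpose (lumped_mass_matrix \<Omega> \<phi>) = lumped_mass_matrix \<Omega> \<phi>"
      by (simp add: transpose_def lumped_mass_matrix_def vec_eq_iff)
    then show "transpose Mt = Mt" using choice mass_symmetric[OF mesh domain] by auto
    fix x :: "real^'m"
    have "x \<bullet> (A *v x) \<le> c * C_grad CARD('n) *
        (\<Sum>i\<in>UNIV. (x $ i)\<^sup>2 * (\<Sum>K\<in>patch T (p i). vol K * metric_norm D (F K) K))"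
      unfolding stiffness \<phi>
      by (rule stiffness_form_upper_bound[OF mesh domain diffusion inj reference maps c loc])
    also have "\<dots> \<le> c * C_grad CARD('n) * (\<Sum>i\<in>UNIV. (x $ i)\<^sup>2 * (patch_vol T (p i) * ?R))"
    proof (intro mult_left_mono sum_mono)
      fix i
      have "(\<Sum>K\<in>patch T (p i). vol K * metric_norm D (F K) K) = patch_vol T (p i) * ?S i"
        using \<omega>[of i] by (simp add: sum_distrib_left)
      then show "(\<Sum>K\<in>patch T (p i). vol K * metric_norm D (F K) K) \<le> patch_vol T (p i) * ?R"
        using S_le[of i] \<omega>[of i] by simp
    qed (use c Cg in auto)
    also have "\<dots> = Cstar * C_sharp CARD('n) * ?R * (k / ((?d + 1) * (?d + 2)) * ?W x)"
    proof -
      have "(\<Sum>i\<in>UNIV. (x $ i)\<^sup>2 * (patch_vol T (p i) * ?R)) = ?R * ?W x"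
        unfolding sum_distrib_left by (intro sum.cong refl) (simp only: mult_ac)
      moreover have "(?d + 1) * (?d + 2) \<noteq> 0" by (simp add: add_nonneg_eq_0_iff)
      ultimately show ?thesis using k by (simp add: Cstar C_sharp)
    qed
    also have "\<dots> \<le> Cstar * C_sharp CARD('n) * ?R * (x \<bullet> (Mt *v x))"
      using mass[of x] c k Cg R by (intro mult_left_mono) (auto simp: Cstar C_sharp)
    finally show "x \<bullet> (A *v x) \<le> Cstar * C_sharp CARD('n) * ?R * (x \<bullet> (Mt *v x))" .
  next
    fix x :: "real^'m" assume "x \<noteq> 0"
    then obtain i where "x $ i \<noteq> 0" by (auto simp: vec_eq_iff)
    then have "0 < ?W x"
      using \<omega> by (intro sum_pos2[where i = i]) (simp_all add: less_imp_le)
    then have "0 < k / ((?d + 1) * (?d + 2)) * ?W x"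
      using k by (intro mult_pos_pos divide_pos_pos) auto
    then show "0 < x \<bullet> (Mt *v x)" using mass[of x] by linarith
  qed
  let ?h = "(metric_h T D)\<^sup>2"
  have h: "0 < ?h" using metric_h_pos[OF mesh domain diffusion] by simp
  have "(\<Sum>K\<in>patch T (p i). vol K / patch_vol T (p i) * quality T D (F K) K) = ?h * ?S i" for i
    by (simp add: quality_def sum_distrib_left mult_ac)
  then have "range (\<lambda>i. \<Sum>K\<in>patch T (p i). vol K / patch_vol T (p i) * quality T D (F K) K) =
      (\<lambda>s. ?h * s) ` range ?S" by auto
  moreover have "Max ((\<lambda>s. ?h * s) ` range ?S) = ?h * ?R"
    using h by (intro mono_Max_commute[symmetric] monoI) auto
  ultimately show "Cstar * C_sharp CARD('n) * ?R = Cstar * C_sharp CARD('n) * inverse ?h *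
      Max (range (\<lambda>i. \<Sum>K\<in>patch T (p i). vol K / patch_vol T (p i) * quality T D (F K) K))"
    using h by simp
qed


end
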